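(* Let $\nu$ be a Borel probability measure on $\mathbb{R}^d$ whose support lies in the interior of $[0,1]^d$, and assume that there are $a>0$ and $C\ge1$ with $\nu(Q)\le C2^{-ak}$ for all $Q\in\mathcal D_k$, $k\ge0$. Put $$Z_\nu(q)=\sum_{Q\in\mathcal D}\nu(Q)^q=\sum_{k\ge0}\sum_{Q\in\mathcal D_k}\nu(Q)^q,\qquad q>1,$$ which is finite. With $F_\nu(u)=\sum_{Q\in\mathcal D,\ -\log\nu(Q)\le u}\nu(Q)$ for $u\in\mathbb{R}$, we have $F_\nu(u)=\mathcal L_\nu(2^{-u})$ for $u>0$ and $F_\nu(u)=0$ for $u<0$; $F_\nu$ is non-decreasing and right-continuous and hence defines a positive Lebesgue–Stieltjes measure, including its atom at zero. Then $$Z_\nu(1+\lambda)=\int_{[0,\infty)}2^{-\lambda u}\,dF_\nu(u)\qquad(\lambda>0),$$ and $$\frac1{\overline D_0(\nu)}\le\liminf_{q\downarrow1}(q-1)\ln2\,Z_\nu(q)\le\limsup_{q\downarrow1}(q-1)\ln2\,Z_\nu(q)\le\frac1{\underline D_0(\nu)}.$$ The dimension $D_0(\nu)$ exists (i.e. $\underline D_0(\nu)=\overline D_0(\nu)$) if and only if $(q-1)Z_\nu(q)$ converges as $q\downarrow1$, and then $$D_0(\nu)=\Bigl(\lim_{q\downarrow1}(q-1)\ln2\sum_{Q\in\mathcal D}\nu(Q)^q\Bigr)^{-1}.$$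
   Context: $\log$ is the logarithm to base 2 and $\ln$ the natural logarithm; $\mathbb{R}^d$ carries the maximum norm. $\mathcal D_k$ is the partition of the root cube $[0,1]^d$ into $2^{dk}$ dyadic cubes of side length $2^{-k}$ (half-open cubes, with the outer boundary faces of $[0,1]^d$ assigned to the adjacent end cubes, so that the partitions are disjoint and nested, $\mathcal D_0=\{[0,1]^d\}$); $\mathcal D=\bigcup_{k\ge0}\mathcal D_k$. Zero-mass cubes are omitted from mass sums. For $Q\in\mathcal D_k$ put $\ell(Q)=2^{-k}$, and let $Q^-\in\mathcal D_{k-1}$ be its parent ($k\ge1$). For $0<t<1$: $P_\nu(t)=\{Q\in\mathcal D\setminus\mathcal D_0:0<\nu(Q)<t\le\nu(Q^-)\}$ and $\mathcal L_\nu(t)=-\sum_{Q\in P_\nu(t)}\nu(Q)\log\ell(Q)$. Quantization: for $N\ge1$, $\mathfrak e_{N,0}(\nu)=\inf_{1\le\#A\le N}\exp\bigl(\int\ln d(x,A)\,d\nu(x)\bigr)$, infimum over non-empty finite $A\subset\mathbb{R}^d$, $d(x,A)=\inf_{y\in A}\|x-y\|_\infty$; $\underline D_0(\nu)=\liminf_{N\to\infty}\frac{\log N}{-\log\mathfrak e_{N,0}(\nu)}$ and $\overline D_0(\nu)=\limsup_{N\to\infty}\frac{\log N}{-\log\mathfrak e_{N,0}(\nu)}$; $D_0(\nu)$ is their common value when they agree. *)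

theory Defs
  imports "HOL-Probability.Probability"
begin

definition msupport :: "'a::topological_space measure \<Rightarrow> 'a set" where
  "msupport \<nu> = {x. \<forall>U. open U \<longrightarrow> x \<in> U \<longrightarrow> emeasure \<nu> U > 0}"

subsection \<open>Dyadic cubes of \<open>[0,1]\<^sup>d\<close>, where \<open>d = CARD('n)\<close>\<close>

text \<open>Intervals are closed on the left and open on the right, except that the last one of each
  generation contains the endpoint 1.\<close>

definition dyadic_interval :: "nat \<Rightarrow> nat \<Rightarrow> real set" where
  "dyadic_interval k j =
     (if j = 2 ^ k - 1 then {real j / 2 ^ k .. 1} else {real j / 2 ^ k ..< real (j + 1) / 2 ^ k})"

definition dyadic_cubes :: "nat \<Rightarrow> (real ^ 'n) set set" where
  "dyadic_cubes k =
     {{x. \<forall>i. x $ i \<in> dyadic_interval k (j i)} |j :: 'n \<Rightarrow> nat. \<forall>i. j i < 2 ^ k}"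

definition all_dyadic_cubes :: "(real ^ 'n) set set" where
  "all_dyadic_cubes = (\<Union>k. dyadic_cubes k)"

text \<open>Cubes of different generations are different as point sets, so the generation of a cube
  is determined by the set.\<close>

definition generation :: "(real ^ 'n) set \<Rightarrow> nat" where
  "generation Q = (THE k. Q \<in> dyadic_cubes k)"

definition side_length :: "(real ^ 'n) set \<Rightarrow> real" where
  "side_length Q = 1 / 2 ^ generation Q"

text \<open>Only meaningful for cubes of generation at least 1.\<close>

definition parent :: "(real ^ 'n) set \<Rightarrow> (real ^ 'n) set" where
  "parent Q = (THE R. R \<in> dyadic_cubes (generation Q - 1) \<and> Q \<subseteq> R)"

subsection \<open>Mass sums\<close>

text \<open>Cubes of zero mass are excluded explicitly where needed: in Isabelle \<open>log 2 0 = 0\<close>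
  rather than \<open>-\<infinity>\<close>.\<close>

definition mass_cubes :: "(real ^ 'n) measure \<Rightarrow> (real ^ 'n) set set" where
  "mass_cubes \<nu> = {Q \<in> all_dyadic_cubes. measure \<nu> Q > 0}"

definition Z_sum :: "(real ^ 'n) measure \<Rightarrow> real \<Rightarrow> real" where
  "Z_sum \<nu> q = (\<Sum>\<^sub>\<infinity>Q\<in>mass_cubes \<nu>. measure \<nu> Q powr q)"

definition P_cubes :: "(real ^ 'n) measure \<Rightarrow> real \<Rightarrow> (real ^ 'n) set set" where
  "P_cubes \<nu> t = {Q \<in> all_dyadic_cubes - dyadic_cubes 0.
              0 < measure \<nu> Q \<and> measure \<nu> Q < t \<and> t \<le> measure \<nu> (parent Q)}"

definition L_fun :: "(real ^ 'n) measure \<Rightarrow> real \<Rightarrow> real" where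
  "L_fun \<nu> t = - (\<Sum>\<^sub>\<infinity>Q\<in>P_cubes \<nu> t. measure \<nu> Q * log 2 (side_length Q))"

definition F_cubes :: "(real ^ 'n) measure \<Rightarrow> real \<Rightarrow> (real ^ 'n) set set" where
  "F_cubes \<nu> u = {Q \<in> mass_cubes \<nu>. - log 2 (measure \<nu> Q) \<le> u}"

definition F_fun :: "(real ^ 'n) measure \<Rightarrow> real \<Rightarrow> real" where
  "F_fun \<nu> u = (\<Sum>\<^sub>\<infinity>Q\<in>F_cubes \<nu> u. measure \<nu> Q)"

subsection \<open>Geometric mean quantization\<close>

text \<open>The integral of \<open>ln d(x,A)\<close> may be \<open>-\<infinity>\<close> for a general measure, so logarithm,
  integral and exponential are taken in the extended reals.\<close>

definition ext_ln :: "real \<Rightarrow> ereal" where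
  "ext_ln r = (if r > 0 then ereal (ln r) else -\<infinity>)"

fun ext_exp :: "ereal \<Rightarrow> ereal" where
  "ext_exp (ereal r) = ereal (exp r)"
| "ext_exp PInfty = \<infinity>"
| "ext_exp MInfty = 0"

fun ext_log2 :: "ereal \<Rightarrow> ereal" where
  "ext_log2 (ereal r) = (if r > 0 then ereal (log 2 r) else -\<infinity>)"
| "ext_log2 PInfty = \<infinity>"
| "ext_log2 MInfty = -\<infinity>"

definition ext_integral :: "'a measure \<Rightarrow> ('a \<Rightarrow> ereal) \<Rightarrow> ereal" where
  "ext_integral M f =
     enn2ereal (\<integral>\<^sup>+x. e2ennreal (f x) \<partial>M) - enn2ereal (\<integral>\<^sup>+x. e2ennreal (- f x) \<partial>M)"

text \<open>The constant \<open>infnorm\<close> is the maximum norm on \<open>real ^ 'n\<close>.\<close>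

definition max_dist :: "real ^ 'n \<Rightarrow> (real ^ 'n) set \<Rightarrow> real" where
  "max_dist x A = (INF y\<in>A. infnorm (x - y))"

definition quant_error :: "nat \<Rightarrow> (real ^ 'n) measure \<Rightarrow> ereal" where
  "quant_error N \<nu> = (INF A\<in>{A. finite A \<and> 1 \<le> card A \<and> card A \<le> N}.
     ext_exp (ext_integral \<nu> (\<lambda>x. ext_ln (max_dist x A))))"

definition lower_quant_dim :: "(real ^ 'n) measure \<Rightarrow> ereal" where
  "lower_quant_dim \<nu> =
     liminf (\<lambda>N. ereal (log 2 (real N)) / (- ext_log2 (quant_error N \<nu>)))"

definition upper_quant_dim :: "(real ^ 'n) measure \<Rightarrow> ereal" where
  "upper_quant_dim \<nu> =
     limsup (\<lambda>N. ereal (log 2 (real N)) / (- ext_log2 (quant_error N \<nu>)))"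

definition quant_dim_exists :: "(real ^ 'n) measure \<Rightarrow> bool" where
  "quant_dim_exists \<nu> \<longleftrightarrow> lower_quant_dim \<nu> = upper_quant_dim \<nu>"

definition quant_dim :: "(real ^ 'n) measure \<Rightarrow> ereal" where
  "quant_dim \<nu> = (THE D. lower_quant_dim \<nu> = D \<and> upper_quant_dim \<nu> = D)"

end

(*
  For x in the unit cube and t = 2^(-u) let k(x) be the number of dyadic cubes containing x whose
  mass is at least t.  These cubes form an initial segment of the generations, so F(u) is the integral
  of k, and k(x) is the generation of the cube of P(t) containing x; this gives F(u) = L(t).

  Quantization.  Picking one point in each of the at most 2^u F(u) cubes of mass at least t gives
  -log d(x,A) >= k(x) - 1, hence -log e_N >= F(u) - 1.  Conversely, if #A <= N, then
  -log d(x,A) <= k(x) + #{s : d(x,A) < 2^(-k(x)-s)}, and for fixed s such x are covered by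
  O(N u) cubes of mass at most min(t, C 2^(-as)) <= t^(1-e) (C 2^(-as))^e.  The covering terms are
  summable over s, and for N = 2^((1-2e)u) their sum tends to 0, so -log e_N <= F(u) + o(1).
  Thus the quantization dimensions are the reciprocals of the lower and upper limits of F(u)/u.

  Dirichlet series.  Z(1 + s/ln 2) = s * integral of exp(-s u) F(u) du.  Linear bounds on F therefore
  pass to s Z(1 + s/ln 2), and Karamata's Tauberian argument (Weierstrass approximation of a cut-off
  1/y by polynomials in y = nu(Q)^s) converts a limit of (q-1) Z(q) into a limit of F(u)/u.
*)
theory Submission
  imports Defs "HOL-Real_Asymp.Real_Asymp"
begin

section \<open>Dyadic cubes\<close>

text \<open>Only the ratio of \<open>log 2 N\<close> to \<open>u\<close> matters in the end, so a
  loss of \<open>2 powr (e * u)\<close> is harmless once \<open>e\<close> is taken small; this is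
  what permits crude factors such as the number of generations, which is linear in \<open>u\<close>.
  The interpolated mass bound is forced: the bound \<open>2 powr (- u)\<close> alone cannot be
  summed over s, and the decay in s alone is not small against N. Passing from linear bounds on F to
  the Dirichlet series is Abelian and gives the chain of inequalities, hence convergence when the
  dimension exists. Only the converse is Tauberian. There the cut-off sits at y = 1/2 because
  \<open>measure \<nu> Q powr s >= 1/2\<close> means that \<open>- log 2\<close> of the mass is at
  most 1/s, so that s F(1/s) is the value of a positive functional at 1/y cut off to [1/2, 1]. The
  limit c times the integral of 1/y over [1/2, 1] is c ln 2, which is the source of the factor ln 2
  in the formula for the dimension.\<close>

definition dyadic_index :: "nat \<Rightarrow> real \<Rightarrow> int" where
  "dyadic_index k r = min \<lfloor>2 ^ k * r\<rfloor> (2 ^ k - 1)"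

text \<open>Clipping in \<open>dyadic_index\<close> sends the endpoint 1 to the last interval. Cubes
  thus become classes of points with equal index vectors, and nesting and disjointness become
  statements about integers.\<close>

definition cube_at :: "nat \<Rightarrow> real ^ 'n \<Rightarrow> (real ^ 'n) set" where
  "cube_at k x = {y \<in> cbox 0 1. \<forall>i. dyadic_index k (y $ i) = dyadic_index k (x $ i)}"

lemma mem_unit_cube: "x \<in> cbox 0 (1 :: real ^ 'n) \<longleftrightarrow> (\<forall>i. 0 \<le> x $ i \<and> x $ i \<le> 1)"
  by (simp add: mem_box_cart)

text \<open>The last bound is not strict because of \<open>r = 1\<close>, the only point of the unit
  interval where clipping acts.\<close>

lemma dyadic_index_bounds:
  assumes "0 \<le> r" "r \<le> 1"
  shows "0 \<le> dyadic_index k r" "dyadic_index k r < 2 ^ k"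
    "of_int (dyadic_index k r) / 2 ^ k \<le> r" "r \<le> (of_int (dyadic_index k r) + 1) / 2 ^ k"
proof -
  show "0 \<le> dyadic_index k r" "dyadic_index k r < 2 ^ k"
    using assms by (auto simp: dyadic_index_def)
  have "of_int (dyadic_index k r) \<le> 2 ^ k * r"
    by (metis dyadic_index_def le_floor_iff min.cobounded1)
  then show "of_int (dyadic_index k r) / 2 ^ k \<le> r"
    by (simp add: field_simps)
  have "2 ^ k * r \<le> of_int (dyadic_index k r) + 1"
  proof (cases "\<lfloor>2 ^ k * r\<rfloor> \<le> (2 ^ k - 1 :: int)")
    case True
    then have "dyadic_index k r = \<lfloor>2 ^ k * r\<rfloor>" by (simp add: dyadic_index_def)
    then show ?thesis by linarith
  next
    case False
    then have "dyadic_index k r = 2 ^ k - 1" by (simp add: dyadic_index_def)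
    then show ?thesis using assms by simp
  qed
  then show "r \<le> (of_int (dyadic_index k r) + 1) / 2 ^ k"
    by (simp add: field_simps)
qed

lemma dyadic_index_eqI:
  assumes "0 \<le> j" "j < 2 ^ k" "of_int j / 2 ^ k \<le> r" "r < (of_int j + 1) / 2 ^ k"
  shows "dyadic_index k r = j"
proof -
  have "of_int j \<le> 2 ^ k * r" "2 ^ k * r < of_int j + 1"
    using assms by (simp_all add: field_simps)
  then have "\<lfloor>2 ^ k * r\<rfloor> = j" by (simp add: floor_eq_iff)
  then show ?thesis using assms by (simp add: dyadic_index_def)
qed

lemma mem_dyadic_interval:
  assumes "j < 2 ^ k"
  shows "r \<in> dyadic_interval k j \<longleftrightarrow> 0 \<le> r \<and> r \<le> 1 \<and> dyadic_index k r = int j"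
proof
  assume r: "r \<in> dyadic_interval k j"
  have "real (j + 1) \<le> real (2 ^ k)" using assms by (intro of_nat_mono) simp
  then have j1: "real (j + 1) \<le> 2 ^ k" by simp
  have "int j < int (2 ^ k)" using assms by (simp only: of_nat_less_iff)
  then have j2: "int j < 2 ^ k" by simp
  have low: "real j / 2 ^ k \<le> r" using r by (auto simp: dyadic_interval_def split: if_splits)
  moreover have "0 \<le> real j / 2 ^ k" by simp
  ultimately have "0 \<le> r" by linarith
  show "0 \<le> r \<and> r \<le> 1 \<and> dyadic_index k r = int j"
  proof (cases "j = 2 ^ k - 1")
    case True
    then have r1: "r \<le> 1" using r by (simp add: dyadic_interval_def)
    have ij: "int j = 2 ^ k - 1" using True by (simp add: of_nat_diff)
    have "real j \<le> 2 ^ k * r" using low by (simp add: field_simps)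
    then have "int j \<le> \<lfloor>2 ^ k * r\<rfloor>" by (simp add: le_floor_iff)
    then show ?thesis using r1 \<open>0 \<le> r\<close> ij by (simp add: dyadic_index_def)
  next
    case False
    then have hi: "r < real (j + 1) / 2 ^ k" using r by (simp add: dyadic_interval_def)
    have "dyadic_index k r = int j"
      by (rule dyadic_index_eqI) (use low hi j2 in \<open>auto simp: add.commute\<close>)
    moreover have "real (j + 1) / 2 ^ k \<le> 1" using j1 by (simp add: field_simps)
    ultimately show ?thesis using \<open>0 \<le> r\<close> hi by linarith
  qed
next
  assume r: "0 \<le> r \<and> r \<le> 1 \<and> dyadic_index k r = int j"
  have low: "real j / 2 ^ k \<le> r" using dyadic_index_bounds(3)[of r k] r by simp
  show "r \<in> dyadic_interval k j"
  proof (cases "j = 2 ^ k - 1")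
    case True
    then show ?thesis using low r by (simp add: dyadic_interval_def)
  next
    case False
    then have "j + 1 < 2 ^ k" using assms by linarith
    then have "int (j + 1) < int (2 ^ k)" by (simp only: of_nat_less_iff)
    then have "int j + 1 < 2 ^ k" by simp
    then have "\<lfloor>2 ^ k * r\<rfloor> = int j" using r by (auto simp: dyadic_index_def min_def split: if_splits)
    then have "2 ^ k * r < int j + 1" by linarith
    then have "r < real (j + 1) / 2 ^ k" by (simp add: field_simps)
    then show ?thesis using low False by (simp add: dyadic_interval_def)
  qed
qed

lemma dyadic_cubes_eq: "dyadic_cubes k = cube_at k ` cbox 0 (1 :: real ^ 'n)"
proof (intro subset_antisym subsetI)
  fix Q :: "(real ^ 'n) set"
  assume "Q \<in> dyadic_cubes k"
  then obtain j :: "'n \<Rightarrow> nat" where j: "\<And>i. j i < 2 ^ k"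
    and Q: "Q = {x. \<forall>i. x $ i \<in> dyadic_interval k (j i)}"
    by (auto simp: dyadic_cubes_def)
  \<comment> \<open>The lower corner belongs to the half-open cube and serves as its
    representative.\<close>
  define x :: "real ^ 'n" where "x = (\<chi> i. real (j i) / 2 ^ k)"
  have x: "x $ i \<in> dyadic_interval k (j i)" for i
  proof -
    have "real (j i + 1) \<le> real (2 ^ k)" using j[of i] by (intro of_nat_mono) simp
    then have "real (j i) + 1 \<le> 2 ^ k" by simp
    then show ?thesis
      by (auto simp: x_def dyadic_interval_def field_simps)
  qed
  have "x \<in> cbox 0 1" using x mem_dyadic_interval[OF j] by (auto simp: mem_unit_cube)
  moreover have "Q = cube_at k x"
    using x mem_dyadic_interval[OF j] by (auto simp: Q cube_at_def mem_unit_cube)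
  ultimately show "Q \<in> cube_at k ` cbox 0 1" by blast
next
  fix Q :: "(real ^ 'n) set"
  assume "Q \<in> cube_at k ` cbox 0 1"
  then obtain x where x: "x \<in> cbox 0 1" and Q: "Q = cube_at k x" by blast
  define j where "j i = nat (dyadic_index k (x $ i))" for i
  have x': "0 \<le> x $ i" "x $ i \<le> 1" for i using x by (auto simp: mem_unit_cube)
  have j: "j i < 2 ^ k" "int (j i) = dyadic_index k (x $ i)" for i
    using dyadic_index_bounds(1,2)[OF x'[of i], of k] unfolding j_def
    by (simp_all add: nat_less_iff)
  have "Q = {y. \<forall>i. y $ i \<in> dyadic_interval k (j i)}"
    using mem_dyadic_interval[OF j(1)] j(2) by (auto simp: Q cube_at_def mem_unit_cube)
  then show "Q \<in> dyadic_cubes k" using j(1) unfolding dyadic_cubes_def by blast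
qed

lemma cube_at_in_dyadic_cubes: "x \<in> cbox 0 1 \<Longrightarrow> cube_at k x \<in> dyadic_cubes k"
  by (auto simp: dyadic_cubes_eq)

lemma mem_cube_at_self: "x \<in> cbox 0 1 \<Longrightarrow> x \<in> cube_at k x"
  by (simp add: cube_at_def)

lemma dyadic_cube_eq_cube_at: "Q \<in> dyadic_cubes k \<Longrightarrow> x \<in> Q \<Longrightarrow> Q = cube_at k x"
  by (auto simp: dyadic_cubes_eq cube_at_def)

lemma dyadic_cube_subset: "Q \<in> dyadic_cubes k \<Longrightarrow> Q \<subseteq> cbox 0 1"
  by (auto simp: dyadic_cubes_eq cube_at_def)

lemma dyadic_cubes_0: "dyadic_cubes 0 = {cbox 0 (1 :: real ^ 'n)}"
proof -
  have "dyadic_index 0 r = 0" if "0 \<le> r" "r \<le> 1" for r :: real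
    using dyadic_index_bounds(1,2)[OF that, of 0] by simp
  then have "cube_at 0 x = cbox 0 1" if "x \<in> cbox 0 (1 :: real ^ 'n)" for x
    using that by (auto simp: cube_at_def mem_unit_cube)
  moreover have "(0 :: real ^ 'n) \<in> cbox 0 1" by (simp add: mem_unit_cube)
  ultimately show ?thesis unfolding dyadic_cubes_eq by (metis image_cong image_constant)
qed

lemma cube_at_0: "x \<in> cbox 0 (1 :: real ^ 'n) \<Longrightarrow> cube_at 0 x = cbox 0 1"
  using cube_at_in_dyadic_cubes[of x 0] dyadic_cubes_0 by blast

lemma dyadic_index_Suc: "dyadic_index k r = dyadic_index (Suc k) r div 2"
proof -
  have "\<lfloor>2 ^ k * r\<rfloor> = \<lfloor>(2 ^ Suc k * r) / real_of_int 2\<rfloor>" by simp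
  also have "\<dots> = \<lfloor>2 ^ Suc k * r\<rfloor> div 2" by (rule floor_divide_real_eq_div) simp
  finally have *: "\<lfloor>2 ^ k * r\<rfloor> = \<lfloor>2 ^ Suc k * r\<rfloor> div 2" .
  \<comment> \<open>Clipping commutes with halving: the last index of generation k+1 halves to the
    last index of generation k.\<close>
  have "min b (2 * m - 1) div 2 = min (b div 2) (m - 1)" for b m :: int
    by linarith
  then show ?thesis unfolding dyadic_index_def * by simp
qed

lemma cube_at_antimono:
  assumes "k \<le> m"
  shows "cube_at m x \<subseteq> cube_at k x"
proof -
  have "cube_at (Suc n) x \<subseteq> cube_at n x" for n
    unfolding cube_at_def by (auto simp: dyadic_index_Suc[of n])
  then show ?thesis by (rule lift_Suc_antimono_le[OF _ assms])
qed

lemma dyadic_cube_component_dist: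
  assumes "Q \<in> dyadic_cubes k" "x \<in> Q" "y \<in> Q"
  shows "\<bar>x $ i - y $ i\<bar> \<le> 1 / 2 ^ k"
proof -
  have "Q = cube_at k x" using assms dyadic_cube_eq_cube_at by blast
  then have idx: "dyadic_index k (y $ i) = dyadic_index k (x $ i)"
    using assms by (simp add: cube_at_def)
  have "0 \<le> x $ i" "x $ i \<le> 1" "0 \<le> y $ i" "y $ i \<le> 1"
    using assms dyadic_cube_subset[of Q k] by (auto simp: mem_unit_cube subset_iff)
  then show ?thesis
    using dyadic_index_bounds(3,4)[of "x $ i" k] dyadic_index_bounds(3,4)[of "y $ i" k] idx
    by (simp add: add_divide_distrib)
qed

lemma infnorm_dyadic_cube_le:
  fixes x y :: "real ^ 'n"
  assumes "Q \<in> dyadic_cubes k" "x \<in> Q" "y \<in> Q"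
  shows "infnorm (x - y) \<le> 1 / 2 ^ k"
  unfolding infnorm_cart
  by (rule cSup_least) (use dyadic_cube_component_dist[OF assms] in auto)

text \<open>A cube of generation k contains two points at distance 3/4 of its side, while a finer
  cube has diameter at most 1/2 of it. A full side may not be attained, as the cube can be
  half-open; any fraction strictly between 1/2 and 1 would do.\<close>

lemma dyadic_cubes_generation_unique_aux:
  fixes Q :: "(real ^ 'n) set"
  assumes "Q \<in> dyadic_cubes k" "Q \<in> dyadic_cubes m"
  shows "\<not> k < m"
proof
  assume "k < m"
  obtain x where x: "x \<in> cbox 0 1" "Q = cube_at k x" using assms by (auto simp: dyadic_cubes_eq)
  define j where "j i = dyadic_index k (x $ i)" for i
  have j: "0 \<le> j i" "j i < 2 ^ k" for i
    using x dyadic_index_bounds(1,2)[of "x $ i" k] by (auto simp: j_def mem_unit_cube)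
  have j': "0 \<le> real_of_int (j i)" "real_of_int (j i) + 1 \<le> 2 ^ k" for i
  proof -
    show "0 \<le> real_of_int (j i)" using j by simp
    have "j i + 1 \<le> 2 ^ k" using j[of i] by simp
    then have "real_of_int (j i + 1) \<le> real_of_int (2 ^ k)" using of_int_le_iff by blast
    then show "real_of_int (j i) + 1 \<le> 2 ^ k" by simp
  qed
  have mem: "(\<chi> i. (of_int (j i) + e) / 2 ^ k) \<in> Q" if "0 \<le> e" "e < 1" for e :: real
  proof -
    have "(of_int (j i) + e) / 2 ^ k \<le> 1" "0 \<le> (of_int (j i) + e) / 2 ^ k" for i
      using j'[of i] that by (simp_all add: field_simps)
    moreover have "dyadic_index k ((of_int (j i) + e) / 2 ^ k) = j i" for i
      using j[of i] that by (intro dyadic_index_eqI) (auto simp: divide_right_mono divide_strict_right_mono)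
    ultimately show ?thesis by (simp add: x cube_at_def mem_unit_cube j_def)
  qed
  obtain i :: 'n where True by blast
  have "\<bar>(real_of_int (j i) + 0) / 2 ^ k - (of_int (j i) + 3 / 4) / 2 ^ k\<bar> \<le> 1 / 2 ^ m"
    using dyadic_cube_component_dist[OF assms(2) mem[of 0] mem[of "3/4"], of i] by simp
  then have "3 / 4 / 2 ^ k \<le> 1 / (2 ^ m :: real)" by (simp add: add_divide_distrib)
  also have "\<dots> \<le> 1 / 2 ^ Suc k" using \<open>k < m\<close> by (intro divide_left_mono power_increasing) auto
  finally show False by (simp add: field_simps)
qed

lemma dyadic_cubes_generation_unique:
  "Q \<in> dyadic_cubes k \<Longrightarrow> Q \<in> dyadic_cubes m \<Longrightarrow> k = m"
  using dyadic_cubes_generation_unique_aux linorder_neqE_nat by metis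

lemma generation_eq: "Q \<in> dyadic_cubes k \<Longrightarrow> generation Q = k"
  unfolding generation_def using dyadic_cubes_generation_unique by blast

lemma parent_cube_at:
  assumes "x \<in> cbox 0 1"
  shows "parent (cube_at (Suc k) x) = cube_at k x"
proof -
  have "generation (cube_at (Suc k) x) = Suc k"
    using assms cube_at_in_dyadic_cubes generation_eq by blast
  moreover have "R = cube_at k x" if "R \<in> dyadic_cubes k" "cube_at (Suc k) x \<subseteq> R" for R
    using that mem_cube_at_self[OF assms] dyadic_cube_eq_cube_at by blast
  moreover have "cube_at (Suc k) x \<subseteq> cube_at k x" by (rule cube_at_antimono) simp
  ultimately show ?thesis unfolding parent_def
    using cube_at_in_dyadic_cubes[OF assms] by (intro the_equality) auto
qed

lemma finite_dyadic_cubes: "finite (dyadic_cubes k :: (real ^ 'n) set set)"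
proof -
  have "dyadic_cubes k \<subseteq>
    (\<lambda>j :: 'n \<Rightarrow> nat. {x. \<forall>i. x $ i \<in> dyadic_interval k (j i)}) ` (UNIV \<rightarrow> {..<2 ^ k})"
    unfolding dyadic_cubes_def by auto
  moreover have "finite (UNIV \<rightarrow> {..<(2::nat) ^ k} :: ('n \<Rightarrow> nat) set)"
    using finite_PiE[of "UNIV :: 'n set" "\<lambda>_. {..<(2::nat) ^ k}"] by (simp add: PiE_UNIV_domain)
  ultimately show ?thesis by (rule finite_surj[rotated])
qed

lemma countable_all_dyadic_cubes: "countable all_dyadic_cubes"
  unfolding all_dyadic_cubes_def by (auto intro: countable_finite finite_dyadic_cubes)

lemma disjoint_dyadic_cubes: "disjoint_family_on (\<lambda>Q. Q) (dyadic_cubes k)"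
  unfolding disjoint_family_on_def by (metis dyadic_cube_eq_cube_at disjoint_iff)

lemma Union_dyadic_cubes: "\<Union> (dyadic_cubes k) = cbox 0 (1 :: real ^ 'n)"
  using mem_cube_at_self by (fastforce simp: dyadic_cubes_eq cube_at_def)

lemma sets_dyadic_cube:
  assumes "Q \<in> dyadic_cubes k"
  shows "Q \<in> sets borel"
proof -
  obtain j where Q: "Q = {x. \<forall>i. x $ i \<in> dyadic_interval k (j i)}"
    using assms by (auto simp: dyadic_cubes_def)
  have [measurable]: "dyadic_interval k i \<in> sets borel" for i
    by (auto simp: dyadic_interval_def)
  show ?thesis unfolding Q by measurable
qed

text \<open>A shift by less than the side length changes each floor by at most one, and clipping can
  only merge indices, so each coordinate has at most three candidates. The point \<open>y\<close>
  may lie outside the unit cube.\<close>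

lemma card_dyadic_cubes_near:
  fixes y :: "real ^ 'n"
  shows "card {Q \<in> dyadic_cubes m. \<exists>x\<in>Q. infnorm (x - y) < 1 / 2 ^ m} \<le> 3 ^ CARD('n)"
proof -
  define S where "S i = (\<lambda>j. min j (2 ^ m - 1)) ` {\<lfloor>2 ^ m * y $ i\<rfloor> - 1 .. \<lfloor>2 ^ m * y $ i\<rfloor> + 1}" for i
  define c where "c f = {z \<in> cbox 0 1. \<forall>i. dyadic_index m (z $ i) = f i}" for f :: "'n \<Rightarrow> int"
  have S: "finite (S i)" "card (S i) \<le> 3" for i
  proof -
    show "finite (S i)" unfolding S_def by simp
    have "card (S i) \<le> card {\<lfloor>2 ^ m * y $ i\<rfloor> - 1 .. \<lfloor>2 ^ m * y $ i\<rfloor> + 1}"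
      unfolding S_def by (rule card_image_le) simp
    then show "card (S i) \<le> 3" by simp
  qed
  have fin: "finite (PiE UNIV S)" by (rule finite_PiE) (auto simp: S)
  have "{Q \<in> dyadic_cubes m. \<exists>x\<in>Q. infnorm (x - y) < 1 / 2 ^ m} \<subseteq> c ` PiE UNIV S"
  proof safe
    fix Q x assume Q: "Q \<in> dyadic_cubes m" "x \<in> Q" "infnorm (x - y) < 1 / 2 ^ m"
    have "Q = c (\<lambda>i. dyadic_index m (x $ i))"
      using dyadic_cube_eq_cube_at[OF Q(1,2)] by (simp add: c_def cube_at_def)
    moreover have "dyadic_index m (x $ i) \<in> S i" for i
    proof -
      have "\<bar>x $ i - y $ i\<bar> \<le> infnorm (x - y)"
        using component_le_infnorm_cart[of "x - y" i] by simp
      then have "\<bar>x $ i - y $ i\<bar> < 1 / 2 ^ m" using Q by simp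
      then have "2 ^ m * \<bar>x $ i - y $ i\<bar> < 1" by (simp add: field_simps)
      then have "\<bar>2 ^ m * (x $ i) - 2 ^ m * (y $ i)\<bar> < 1"
        by (simp add: abs_mult flip: right_diff_distrib)
      then have "\<lfloor>2 ^ m * y $ i\<rfloor> - 1 \<le> \<lfloor>2 ^ m * x $ i\<rfloor>" "\<lfloor>2 ^ m * x $ i\<rfloor> \<le> \<lfloor>2 ^ m * y $ i\<rfloor> + 1"
        by linarith+
      then have "\<lfloor>2 ^ m * x $ i\<rfloor> \<in> {\<lfloor>2 ^ m * y $ i\<rfloor> - 1 .. \<lfloor>2 ^ m * y $ i\<rfloor> + 1}"
        by simp
      then show ?thesis unfolding S_def dyadic_index_def by blast
    qed
    ultimately show "Q \<in> c ` PiE UNIV S" by (auto simp: PiE_UNIV_domain)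
  qed
  then have "card {Q \<in> dyadic_cubes m. \<exists>x\<in>Q. infnorm (x - y) < 1 / 2 ^ m} \<le> card (PiE UNIV S)"
    using fin by (meson card_image_le card_mono finite_imageI le_trans)
  also have "\<dots> = (\<Prod>i\<in>UNIV. card (S i))" by (rule card_PiE) simp
  also have "\<dots> \<le> (\<Prod>i\<in>(UNIV::'n set). 3)" by (rule prod_mono) (simp add: S)
  finally show ?thesis by simp
qed

section \<open>Measures with decaying dyadic masses\<close>

text \<open>The complement of the support is covered by the null members of a countable
  base.\<close>

lemma AE_msupport:
  fixes M :: "'a :: second_countable_topology measure"
  assumes "sets M = sets borel"
  shows "AE x in M. x \<in> msupport M"
proof -
  obtain B :: "'a set set" where B: "countable B" "topological_basis B"
    using ex_countable_basis by blast
  define N where "N = (\<Union>U\<in>{U \<in> B. emeasure M U = 0}. U)"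
  have "N \<in> null_sets M" unfolding N_def
  proof (rule null_sets_UN')
    show "countable {U \<in> B. emeasure M U = 0}" using B(1) by simp
  next
    fix U assume "U \<in> {U \<in> B. emeasure M U = 0}"
    then show "U \<in> null_sets M"
      using assms topological_basis_open[OF B(2), of U] by (simp add: null_sets_def)
  qed
  moreover have "{x \<in> space M. x \<notin> msupport M} \<subseteq> N"
  proof safe
    fix x assume "x \<notin> msupport M"
    then obtain U where U: "open U" "x \<in> U" "emeasure M U = 0"
      by (auto simp: msupport_def)
    then obtain V where V: "V \<in> B" "x \<in> V" "V \<subseteq> U"
      using B(2) topological_basisE by metis
    have "emeasure M V \<le> emeasure M U" using U V assms by (intro emeasure_mono) auto
    then show "x \<in> N" using U V by (auto simp: N_def)
  qed
  ultimately show ?thesis by (rule AE_I')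
qed

lemma downward_closed_nat_set:
  fixes S :: "nat set"
  assumes "finite S" "\<And>k m. m \<in> S \<Longrightarrow> k \<le> m \<Longrightarrow> k \<in> S"
  shows "S = {..<card S}"
proof (cases "S = {}")
  case False
  have "S = {..<Suc (Max S)}"
  proof (intro subset_antisym subsetI)
    fix k assume "k \<in> S"
    then show "k \<in> {..<Suc (Max S)}" using Max_ge[OF assms(1)] by (simp add: less_Suc_eq_le)
  next
    fix k assume "k \<in> {..<Suc (Max S)}"
    then show "k \<in> S" using assms(2)[OF Max_in[OF assms(1) False]] by (simp add: less_Suc_eq_le)
  qed
  then show ?thesis by (metis card_lessThan)
qed simp

locale dyadic_mass = prob_space \<nu> for \<nu> :: "(real ^ 'n) measure" +
  fixes a C :: real
  assumes sets_eq: "sets \<nu> = sets borel"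
    and AE_unit_cube: "AE x in \<nu>. x \<in> cbox 0 1"
    and a_pos: "a > 0" and C_ge_1: "C \<ge> 1"
    and mass_decay: "\<And>k Q. Q \<in> dyadic_cubes k \<Longrightarrow> measure \<nu> Q \<le> C * 2 powr (- a * real k)"
begin

text \<open>The function k(x) of the overview. Once the counted generations are known to form an
  initial segment, it is also the first generation at which the cube around \<open>x\<close> is
  light.\<close>

definition level :: "real \<Rightarrow> real ^ 'n \<Rightarrow> nat" where
  "level u x = card {k. cube_at k x \<in> F_cubes \<nu> u}"

text \<open>Mass at least \<open>2 powr (- u)\<close> forces a k <= u + log C by the decay; the
  summand 1 is there because generations are counted from 0.\<close>

definition max_level :: "real \<Rightarrow> real" where
  "max_level u = 1 + (u + log 2 C) / a"

lemma sets_cube: "Q \<in> dyadic_cubes k \<Longrightarrow> Q \<in> sets \<nu>"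
  using sets_dyadic_cube sets_eq by blast

lemma sets_all_cubes: "Q \<in> all_dyadic_cubes \<Longrightarrow> Q \<in> sets \<nu>"
  using sets_cube by (auto simp: all_dyadic_cubes_def)

lemma measure_unit_cube: "measure \<nu> (cbox 0 1) = 1"
  using AE_unit_cube prob_Collect_eq_1[of "\<lambda>x. x \<in> cbox 0 1"]
  by (subst prob_eq_1) (auto simp: sets_eq)

lemma sum_measure_dyadic_cubes: "(\<Sum>Q\<in>dyadic_cubes k. measure \<nu> Q) = 1"
proof -
  have "measure \<nu> (\<Union>Q\<in>dyadic_cubes k. Q) = (\<Sum>Q\<in>dyadic_cubes k. measure \<nu> Q)"
    by (rule finite_measure_finite_Union)
       (auto simp: finite_dyadic_cubes sets_cube disjoint_dyadic_cubes)
  then show ?thesis by (simp add: Union_dyadic_cubes measure_unit_cube)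
qed

text \<open>The threshold is positive, so this form excludes null cubes by itself and avoids the
  convention \<open>log 2 0 = 0\<close>.\<close>

lemma F_cubes_iff: "Q \<in> F_cubes \<nu> u \<longleftrightarrow> Q \<in> all_dyadic_cubes \<and> 2 powr (- u) \<le> measure \<nu> Q"
proof -
  have "- log 2 m \<le> u \<longleftrightarrow> 2 powr (- u) \<le> m" if "0 < m" for m :: real
    using that le_log_iff[of 2 m "-u"] by auto
  moreover have "0 < m" if "2 powr (- u) \<le> m" for m :: real
    using that by (rule less_le_trans[rotated]) simp
  ultimately show ?thesis by (auto simp: F_cubes_def mass_cubes_def)
qed

lemma generation_F_cubes_le:
  assumes "Q \<in> dyadic_cubes k" "Q \<in> F_cubes \<nu> u"
  shows "real k \<le> (u + log 2 C) / a"
proof -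
  have "2 powr (- u) \<le> C * 2 powr (- a * real k)"
    using assms mass_decay F_cubes_iff order_trans by blast
  also have "\<dots> = 2 powr (log 2 C - a * real k)"
    using C_ge_1 by (simp add: powr_diff powr_minus_divide)
  finally have "- u \<le> log 2 C - a * real k" by simp
  then show ?thesis using a_pos by (simp add: field_simps)
qed

lemma finite_F_cubes: "finite (F_cubes \<nu> u)"
proof -
  have "F_cubes \<nu> u \<subseteq> (\<Union>k\<le>nat \<lfloor>(u + log 2 C) / a\<rfloor>. dyadic_cubes k)"
  proof
    fix Q assume Q: "Q \<in> F_cubes \<nu> u"
    then obtain k where k: "Q \<in> dyadic_cubes k" by (auto simp: F_cubes_iff all_dyadic_cubes_def)
    have "k \<le> nat \<lfloor>(u + log 2 C) / a\<rfloor>"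
      using generation_F_cubes_le[OF k Q] by (simp add: le_nat_floor)
    then show "Q \<in> (\<Union>k\<le>nat \<lfloor>(u + log 2 C) / a\<rfloor>. dyadic_cubes k)" using k by blast
  qed
  then show ?thesis by (rule finite_subset) (auto intro: finite_dyadic_cubes)
qed

lemma F_fun_eq_sum: "F_fun \<nu> u = (\<Sum>Q\<in>F_cubes \<nu> u. measure \<nu> Q)"
  unfolding F_fun_def by (simp add: finite_F_cubes)

lemma F_fun_nonneg: "0 \<le> F_fun \<nu> u"
  unfolding F_fun_eq_sum by (rule sum_nonneg) simp

lemma F_cubes_mono: "u \<le> v \<Longrightarrow> F_cubes \<nu> u \<subseteq> F_cubes \<nu> v"
  by (auto simp: F_cubes_def)

lemma mono_F_fun: "mono (F_fun \<nu>)"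
  unfolding F_fun_eq_sum by (intro monoI sum_mono2 finite_F_cubes F_cubes_mono) auto

lemma F_fun_neg: "u < 0 \<Longrightarrow> F_fun \<nu> u = 0"
proof -
  assume "u < 0"
  then have "1 < (2::real) powr (- u)" using powr_less_mono[of 0 "-u" 2] by simp
  then have "\<not> 2 powr (- u) \<le> measure \<nu> Q" for Q
    using prob_le_1[of Q] by linarith
  then have "F_cubes \<nu> u = {}" using F_cubes_iff by blast
  then show ?thesis by (simp add: F_fun_eq_sum)
qed

text \<open>Only finitely many cubes enter between \<open>u\<close> and \<open>u + 1\<close>, each
  strictly after \<open>u\<close>, so F is constant on a short interval to the right of
  \<open>u\<close>.\<close>

lemma continuous_F_fun: "continuous (at_right u) (F_fun \<nu>)"
proof -
  have "\<forall>\<^sub>F v in at_right u. \<forall>Q\<in>F_cubes \<nu> (u + 1) - F_cubes \<nu> u. v < - log 2 (measure \<nu> Q)"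
  proof (intro eventually_ball_finite finite_Diff finite_F_cubes ballI)
    fix Q assume "Q \<in> F_cubes \<nu> (u + 1) - F_cubes \<nu> u"
    then have "u < - log 2 (measure \<nu> Q)" by (auto simp: F_cubes_def)
    then show "\<forall>\<^sub>F v in at_right u. v < - log 2 (measure \<nu> Q)"
      unfolding eventually_at_right_field by blast
  qed
  moreover have "\<forall>\<^sub>F v in at_right u. v < u + 1"
    unfolding eventually_at_right_field by (rule exI[of _ "u + 1"]) simp
  moreover have "\<forall>\<^sub>F v in at_right u. u < v" by (rule eventually_at_right_less)
  ultimately have "\<forall>\<^sub>F v in at_right u. F_fun \<nu> v = F_fun \<nu> u"
  proof eventually_elim
    case (elim v)
    have "F_cubes \<nu> v = F_cubes \<nu> u"
    proof
      show "F_cubes \<nu> u \<subseteq> F_cubes \<nu> v" using elim by (intro F_cubes_mono) simp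
      show "F_cubes \<nu> v \<subseteq> F_cubes \<nu> u"
      proof
        fix Q assume Q: "Q \<in> F_cubes \<nu> v"
        then have "Q \<in> F_cubes \<nu> (u + 1)" using F_cubes_mono[of v "u + 1"] elim by auto
        moreover have "\<not> v < - log 2 (measure \<nu> Q)" using Q by (simp add: F_cubes_def)
        ultimately show "Q \<in> F_cubes \<nu> u" using elim by blast
      qed
    qed
    then show ?case by (simp add: F_fun_def)
  qed
  then show ?thesis unfolding continuous_within by (rule tendsto_eventually)
qed

section \<open>Heavy cubes around a point, and F as the integral of their number\<close>

lemma cube_at_F_cubes_iff:
  assumes "x \<in> cbox 0 1"
  shows "cube_at k x \<in> F_cubes \<nu> u \<longleftrightarrow> 2 powr (- u) \<le> measure \<nu> (cube_at k x)"
  using cube_at_in_dyadic_cubes[OF assms] by (auto simp: F_cubes_iff all_dyadic_cubes_def)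

text \<open>Masses decrease along the chain of cubes around \<open>x\<close> and decay uniformly, so
  the heavy generations form a finite initial segment of the natural numbers.\<close>

lemma cube_at_F_cubes_iff_level:
  assumes "x \<in> cbox 0 1"
  shows "cube_at k x \<in> F_cubes \<nu> u \<longleftrightarrow> k < level u x"
proof -
  have "{k. cube_at k x \<in> F_cubes \<nu> u} \<subseteq> {..nat \<lfloor>(u + log 2 C) / a\<rfloor>}"
    using generation_F_cubes_le[OF cube_at_in_dyadic_cubes[OF assms]] by (auto simp: le_nat_floor)
  then have "finite {k. cube_at k x \<in> F_cubes \<nu> u}" by (rule finite_subset) simp
  moreover have "cube_at k x \<in> F_cubes \<nu> u" if "cube_at m x \<in> F_cubes \<nu> u" "k \<le> m" for k m
    using that finite_measure_mono[OF cube_at_antimono[OF that(2)] sets_cube[OF cube_at_in_dyadic_cubes[OF assms]]]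
    by (auto simp: cube_at_F_cubes_iff[OF assms] intro: order_trans)
  ultimately have "{k. cube_at k x \<in> F_cubes \<nu> u} = {..<level u x}"
    unfolding level_def by (intro downward_closed_nat_set) auto
  then show ?thesis by auto
qed

text \<open>Each generation contributes one cube around \<open>x\<close>. The sum of indicators is
  visibly measurable and integrable and replaces \<open>level\<close> inside integrals.\<close>

lemma level_eq_sum:
  assumes "x \<in> cbox 0 1"
  shows "real (level u x) = (\<Sum>R\<in>F_cubes \<nu> u. indicator R x)"
proof -
  have "bij_betw (\<lambda>k. cube_at k x) {..<level u x} {R \<in> F_cubes \<nu> u. x \<in> R}"
  proof (rule bij_betwI')
    fix k m show "(cube_at k x = cube_at m x) = (k = m)"
      using cube_at_in_dyadic_cubes[OF assms] dyadic_cubes_generation_unique by metis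
  next
    fix k assume "k \<in> {..<level u x}"
    then show "cube_at k x \<in> {R \<in> F_cubes \<nu> u. x \<in> R}"
      using cube_at_F_cubes_iff_level[OF assms] mem_cube_at_self[OF assms] by auto
  next
    fix R assume R: "R \<in> {R \<in> F_cubes \<nu> u. x \<in> R}"
    then obtain k where "R \<in> dyadic_cubes k" by (auto simp: F_cubes_iff all_dyadic_cubes_def)
    then have "R = cube_at k x" using R dyadic_cube_eq_cube_at by blast
    then show "\<exists>k\<in>{..<level u x}. R = cube_at k x"
      using R cube_at_F_cubes_iff_level[OF assms] by auto
  qed
  then have "level u x = card {R \<in> F_cubes \<nu> u. x \<in> R}"
    using bij_betw_same_card by fastforce
  then show ?thesis
    using finite_F_cubes[of u] by (simp add: indicator_def sum.If_cases Int_def)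
qed

lemma log_C_nonneg: "0 \<le> log 2 C"
  using C_ge_1 by simp

text \<open>The root cube has mass 1. This keeps the later subtraction \<open>level u x - 1\<close>
  from being truncated.\<close>

lemma level_pos:
  assumes "x \<in> cbox 0 1" "0 \<le> u"
  shows "0 < level u x"
proof -
  have "2 powr (- u) \<le> 1" using assms powr_mono[of "-u" 0 2] by simp
  then have "cube_at 0 x \<in> F_cubes \<nu> u"
    by (subst cube_at_F_cubes_iff[OF assms(1)])
       (simp only: cube_at_0[OF assms(1)] measure_unit_cube)
  then show ?thesis using cube_at_F_cubes_iff_level assms by blast
qed

lemma level_le:
  assumes "x \<in> cbox 0 1" "0 \<le> u"
  shows "real (level u x) \<le> max_level u"
proof -
  have "cube_at (level u x - 1) x \<in> F_cubes \<nu> u"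
    using level_pos[OF assms] cube_at_F_cubes_iff_level[OF assms(1)] by simp
  then have "real (level u x - 1) \<le> (u + log 2 C) / a"
    using generation_F_cubes_le cube_at_in_dyadic_cubes assms by blast
  then show ?thesis using level_pos[OF assms] by (simp add: max_level_def of_nat_diff)
qed

lemma integrable_indicator_cube:
  assumes "R \<in> all_dyadic_cubes"
  shows "integrable \<nu> (indicator R :: _ \<Rightarrow> real)"
  by (rule integrable_real_indicator[OF sets_all_cubes[OF assms]]) (simp add: less_top[symmetric])

lemma integrable_sum_F_cubes: "integrable \<nu> (\<lambda>x. \<Sum>R\<in>F_cubes \<nu> u. indicator R x :: real)"
  by (intro Bochner_Integration.integrable_sum integrable_indicator_cube) (simp add: F_cubes_iff)

lemma integral_sum_F_cubes: "(\<integral>x. (\<Sum>R\<in>F_cubes \<nu> u. indicator R x) \<partial>\<nu>) = F_fun \<nu> u"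
proof -
  have "(\<integral>x. (\<Sum>R\<in>F_cubes \<nu> u. indicator R x) \<partial>\<nu>) = (\<Sum>R\<in>F_cubes \<nu> u. (\<integral>x. indicator R x \<partial>\<nu>) :: real)"
    by (intro Bochner_Integration.integral_sum integrable_indicator_cube) (simp add: F_cubes_iff)
  also have "\<dots> = (\<Sum>R\<in>F_cubes \<nu> u. measure \<nu> R)"
  proof (rule sum.cong[OF refl])
    fix R assume "R \<in> F_cubes \<nu> u"
    then have "R \<subseteq> space \<nu>" using sets_all_cubes sets.sets_into_space by (auto simp: F_cubes_iff)
    then show "(\<integral>x. indicator R x \<partial>\<nu> :: real) = measure \<nu> R" by (simp add: Int_absorb2)
  qed
  finally show ?thesis by (simp add: F_fun_eq_sum)
qed

lemma AE_level: "AE x in \<nu>. real (level u x) = (\<Sum>R\<in>F_cubes \<nu> u. indicator R x)"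
  using AE_unit_cube by eventually_elim (rule level_eq_sum)

lemma nn_integral_level: "(\<integral>\<^sup>+x. ennreal (real (level u x)) \<partial>\<nu>) = ennreal (F_fun \<nu> u)"
proof -
  have "(\<integral>\<^sup>+x. ennreal (real (level u x)) \<partial>\<nu>) = (\<integral>\<^sup>+x. ennreal (\<Sum>R\<in>F_cubes \<nu> u. indicator R x) \<partial>\<nu>)"
    using AE_level[of u] by (intro nn_integral_cong_AE) auto
  also have "\<dots> = ennreal (\<integral>x. (\<Sum>R\<in>F_cubes \<nu> u. indicator R x) \<partial>\<nu>)"
    by (intro nn_integral_eq_integral integrable_sum_F_cubes AE_I2 sum_nonneg) simp
  finally show ?thesis by (simp add: integral_sum_F_cubes)
qed

lemma F_fun_le_max_level: "0 \<le> u \<Longrightarrow> F_fun \<nu> u \<le> max_level u"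
proof -
  assume u: "0 \<le> u"
  have "AE x in \<nu>. (\<Sum>R\<in>F_cubes \<nu> u. indicator R x) \<le> max_level u"
    using AE_unit_cube
  proof eventually_elim
    case (elim x)
    then show ?case using level_le[OF _ u] by (simp only: flip: level_eq_sum)
  qed
  from integral_le_const[OF integrable_sum_F_cubes this]
  show ?thesis by (simp only: integral_sum_F_cubes)
qed

text \<open>A Markov inequality: every summand of F(u) is at least
  \<open>2 powr (- u)\<close>.\<close>

lemma card_F_cubes_le: "real (card (F_cubes \<nu> u)) \<le> 2 powr u * F_fun \<nu> u"
proof -
  have "real (card (F_cubes \<nu> u)) * 2 powr (- u) \<le> F_fun \<nu> u"
    unfolding F_fun_eq_sum by (rule sum_bounded_below) (simp add: F_cubes_iff)
  then show ?thesis by (simp add: powr_minus divide_simps mult.commute)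
qed

section \<open>The stopping partition and the identity of F and L\<close>

lemma AE_cube_at_pos: "AE x in \<nu>. \<forall>k. 0 < measure \<nu> (cube_at k x)"
proof -
  have "countable {Q \<in> all_dyadic_cubes. measure \<nu> Q = 0}"
    by (rule countable_subset[OF _ countable_all_dyadic_cubes]) auto
  then have "AE x in \<nu>. \<forall>Q\<in>{Q \<in> all_dyadic_cubes. measure \<nu> Q = 0}. x \<notin> Q"
  proof (subst AE_ball_countable, assumption, intro ballI AE_not_in)
    fix Q assume "Q \<in> {Q \<in> all_dyadic_cubes. measure \<nu> Q = 0}"
    then show "Q \<in> null_sets \<nu>" by (simp add: null_sets_def sets_all_cubes emeasure_eq_measure)
  qed
  with AE_unit_cube show ?thesis
  proof eventually_elim
    case (elim x)
    then have "measure \<nu> (cube_at k x) \<noteq> 0" for k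
      using mem_cube_at_self[of x k] cube_at_in_dyadic_cubes[of x k]
      unfolding all_dyadic_cubes_def by blast
    then show ?case by (simp only: zero_less_measure_iff) simp
  qed
qed

text \<open>A stopping cube is light with heavy parent, so it sits exactly where the initial segment
  of heavy generations ends. Positivity of the masses is assumed because \<open>P_cubes\<close>
  omits null cubes; it holds for almost every point.\<close>

lemma cube_at_P_cubes_iff:
  assumes "x \<in> cbox 0 1" "0 \<le> u" "\<And>k. 0 < measure \<nu> (cube_at k x)"
  shows "cube_at k x \<in> P_cubes \<nu> (2 powr (- u)) \<longleftrightarrow> k = level u x"
proof (cases k)
  case 0
  have "0 < level u x" using level_pos assms by blast
  moreover have "cube_at 0 x \<notin> P_cubes \<nu> (2 powr (- u))"
    using cube_at_in_dyadic_cubes[OF assms(1), of 0] by (simp add: P_cubes_def)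
  ultimately show ?thesis using 0 by simp
next
  case (Suc m)
  have "cube_at k x \<notin> dyadic_cubes 0"
    using cube_at_in_dyadic_cubes[OF assms(1), of k] dyadic_cubes_generation_unique[of _ k 0] Suc by blast
  then have "cube_at k x \<in> P_cubes \<nu> (2 powr (- u)) \<longleftrightarrow>
      cube_at k x \<notin> F_cubes \<nu> u \<and> cube_at m x \<in> F_cubes \<nu> u"
    using assms(3)[of k] cube_at_in_dyadic_cubes[OF assms(1), of k]
    unfolding P_cubes_def Suc cube_at_F_cubes_iff[OF assms(1)]
      all_dyadic_cubes_def not_le mem_Collect_eq Diff_iff parent_cube_at[OF assms(1)] by blast
  then show ?thesis using Suc by (auto simp: cube_at_F_cubes_iff_level[OF assms(1)])
qed

lemma finite_P_cubes: "finite (P_cubes \<nu> (2 powr (- u)))"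
proof -
  have "P_cubes \<nu> (2 powr (- u)) \<subseteq> (\<Union>k\<le>Suc (nat \<lfloor>(u + log 2 C) / a\<rfloor>). dyadic_cubes k)"
  proof
    fix Q assume Q: "Q \<in> P_cubes \<nu> (2 powr (- u))"
    then obtain k where k: "Q \<in> dyadic_cubes k" "k \<noteq> 0" by (auto simp: P_cubes_def all_dyadic_cubes_def)
    then obtain m x where m: "k = Suc m" and x: "x \<in> cbox 0 1" "Q = cube_at (Suc m) x"
      by (auto simp: dyadic_cubes_eq gr0_conv_Suc)
    then have "cube_at m x \<in> F_cubes \<nu> u"
      using Q by (auto simp: P_cubes_def parent_cube_at cube_at_F_cubes_iff)
    then have "m \<le> nat \<lfloor>(u + log 2 C) / a\<rfloor>"
      using generation_F_cubes_le[OF cube_at_in_dyadic_cubes[OF x(1)]] by (simp add: le_nat_floor)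
    then show "Q \<in> (\<Union>k\<le>Suc (nat \<lfloor>(u + log 2 C) / a\<rfloor>). dyadic_cubes k)" using k m by blast
  qed
  then show ?thesis by (rule finite_subset) (auto intro: finite_dyadic_cubes)
qed

lemma log_side_length: "log 2 (side_length Q) = - real (generation Q)"
  by (simp add: side_length_def log_divide log_nat_power)

text \<open>Both sides integrate \<open>level u\<close>: F counts the heavy cubes around a point,
  while L weights the one stopping cube around it by its generation, which is minus the logarithm of
  its side.\<close>

lemma F_fun_eq_L_fun:
  assumes u: "0 \<le> u"
  shows "F_fun \<nu> u = L_fun \<nu> (2 powr (- u))"
proof -
  let ?P = "P_cubes \<nu> (2 powr (- u))"
  have P_sets: "Q \<in> sets \<nu>" if "Q \<in> ?P" for Q
    using that sets_all_cubes by (auto simp: P_cubes_def)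
  have "AE x in \<nu>. (\<Sum>R\<in>F_cubes \<nu> u. indicator R x) = (\<Sum>Q\<in>?P. real (generation Q) * indicator Q x)"
    using AE_unit_cube AE_cube_at_pos
  proof eventually_elim
    case (elim x)
    let ?Q = "cube_at (level u x) x"
    have iff: "cube_at k x \<in> ?P \<longleftrightarrow> k = level u x" for k
      using cube_at_P_cubes_iff[OF elim(1) u] elim(2) by blast
    have Q: "?Q \<in> ?P" by (simp only: iff)
    have other: "x \<notin> R" if "R \<in> ?P" "R \<noteq> ?Q" for R
    proof
      assume "x \<in> R"
      obtain k where "R \<in> dyadic_cubes k" using \<open>R \<in> ?P\<close> by (auto simp: P_cubes_def all_dyadic_cubes_def)
      then have "R = cube_at k x" using \<open>x \<in> R\<close> dyadic_cube_eq_cube_at by blast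
      then show False using that iff[of k] by blast
    qed
    \<comment> \<open>Exactly one stopping cube contains \<open>x\<close>.\<close>
    have "(\<Sum>R\<in>?P. real (generation R) * indicator R x) = (\<Sum>R\<in>{?Q}. real (generation R) * indicator R x)"
      using Q other finite_P_cubes by (intro sum.mono_neutral_right) (auto simp: indicator_def)
    also have "\<dots> = real (level u x)"
      using generation_eq[OF cube_at_in_dyadic_cubes[OF elim(1)]] mem_cube_at_self[OF elim(1)]
      by simp
    finally show ?case using level_eq_sum elim by simp
  qed
  then have "F_fun \<nu> u = (\<integral>x. (\<Sum>Q\<in>?P. real (generation Q) * indicator Q x) \<partial>\<nu>)"
    using P_sets unfolding integral_sum_F_cubes[symmetric]
    by (intro integral_cong_AE borel_measurable_sum borel_measurable_times
        borel_measurable_indicator borel_measurable_const) (simp_all add: F_cubes_iff sets_all_cubes)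
  also have "\<dots> = (\<Sum>Q\<in>?P. (\<integral>x. real (generation Q) * indicator Q x \<partial>\<nu>))"
    by (intro Bochner_Integration.integral_sum integrable_mult_right integrable_indicator_cube)
       (simp add: P_cubes_def)
  also have "\<dots> = (\<Sum>Q\<in>?P. real (generation Q) * measure \<nu> Q)"
  proof (rule sum.cong[OF refl])
    fix Q assume "Q \<in> ?P"
    then have "Q \<inter> space \<nu> = Q" using sets.sets_into_space[OF P_sets] by blast
    then show "(\<integral>x. real (generation Q) * indicator Q x \<partial>\<nu>) = real (generation Q) * measure \<nu> Q"
      by simp
  qed
  finally show ?thesis
    by (simp add: L_fun_def finite_P_cubes log_side_length sum_negf mult.commute)
qed

end

section \<open>Geometric mean quantization error\<close>

lemma ext_exp_infinity [simp]: "ext_exp \<infinity> = \<infinity>" "ext_exp (- \<infinity>) = 0"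
  using ext_exp.simps(2,3) by (simp_all only: PInfty_eq_infinity MInfty_eq_minfinity)

lemma ext_log2_infinity [simp]: "ext_log2 \<infinity> = \<infinity>" "ext_log2 (- \<infinity>) = - \<infinity>"
  using ext_log2.simps(2,3) by (simp_all only: PInfty_eq_infinity MInfty_eq_minfinity)

lemma ext_exp_mono: "x \<le> y \<Longrightarrow> ext_exp x \<le> ext_exp y"
  by (cases x; cases y) auto

lemma ext_log2_mono: "x \<le> y \<Longrightarrow> ext_log2 x \<le> ext_log2 y"
  by (cases x; cases y) (auto simp: log_le_cancel_iff)

lemma ext_log2_ext_exp: "ext_log2 (ext_exp (ereal (ln 2 * r))) = ereal r"
  by (simp add: log_def)

lemma max_dist_le:
  assumes "finite A" "y \<in> A"
  shows "max_dist x A \<le> infnorm (x - y)"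
  unfolding max_dist_def using assms by (intro cINF_lower) auto

lemma max_dist_attained:
  assumes "finite A" "A \<noteq> {}"
  obtains y where "y \<in> A" "max_dist x A = infnorm (x - y)"
proof -
  have "Inf ((\<lambda>y. infnorm (x - y)) ` A) \<in> (\<lambda>y. infnorm (x - y)) ` A"
    using assms Min_in[of "(\<lambda>y. infnorm (x - y)) ` A"] by (simp add: cInf_eq_Min)
  then show thesis using that unfolding max_dist_def by blast
qed

text \<open>Write m as m^(1-e) m^e and bound each factor separately. With p the threshold and q the
  geometric decay, this keeps most of the smallness in \<open>u\<close> and still allows summation
  over s.\<close>

lemma le_powr_mult_powr:
  fixes m :: real
  assumes "0 \<le> m" "m \<le> p" "m \<le> q" "0 \<le> e" "e \<le> 1"
  shows "m \<le> p powr (1 - e) * q powr e"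
proof (cases "m = 0")
  case False
  then have "m = m powr (1 - e) * m powr e" using assms by (simp flip: powr_add)
  also have "\<dots> \<le> p powr (1 - e) * q powr e"
    using assms by (intro mult_mono powr_mono2) auto
  finally show ?thesis .
qed (use assms in auto)

context dyadic_mass
begin

text \<open>The competitor is a set with one arbitrary point from each heavy cube.\<close>

lemma neg_ext_log2_quant_error_ge:
  assumes u: "0 \<le> u" and N: "card (F_cubes \<nu> u) \<le> N"
  shows "ereal (F_fun \<nu> u - 1) \<le> - ext_log2 (quant_error N \<nu>)"
proof -
  define A where "A = (\<lambda>R. SOME y. y \<in> R) ` F_cubes \<nu> u"
  define f where "f x = ext_ln (max_dist x A)" for x
  define S where "S x = (\<Sum>R\<in>F_cubes \<nu> u. indicator R x :: real)" for x
  have finA: "finite A" unfolding A_def using finite_F_cubes by simp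
  have "(0 :: real ^ 'n) \<in> cbox 0 1" by (simp add: mem_unit_cube)
  then have "cube_at 0 0 \<in> F_cubes \<nu> u"
    using cube_at_F_cubes_iff_level level_pos[OF _ u] by blast
  then have neA: "A \<noteq> {}" unfolding A_def by blast
  have cardA: "card A \<le> N" unfolding A_def using N card_image_le[OF finite_F_cubes] le_trans by blast
  have point: "1 \<le> S x \<and> f x \<le> ereal (- (ln 2 * (S x - 1)))" if x: "x \<in> cbox 0 1" for x
  proof -
    have pos: "0 < level u x" using level_pos x u by blast
    have Sx: "S x = real (level u x)" unfolding S_def by (rule level_eq_sum[OF x, symmetric])
    \<comment> \<open>The smallest heavy cube around \<open>x\<close> has this generation; its side
      bounds the distance to its chosen point. This is where the loss of 1 arises.\<close>
    let ?k = "level u x - 1"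
    have Q: "cube_at ?k x \<in> F_cubes \<nu> u" using pos cube_at_F_cubes_iff_level[OF x] by simp
    define y where "y = (SOME y. y \<in> cube_at ?k x)"
    have y: "y \<in> cube_at ?k x" unfolding y_def using mem_cube_at_self[OF x] by (rule someI)
    have "y \<in> A" unfolding y_def A_def using Q by blast
    then have "max_dist x A \<le> infnorm (x - y)" using max_dist_le finA by blast
    also have "\<dots> \<le> 1 / 2 ^ ?k"
      by (rule infnorm_dyadic_cube_le[OF cube_at_in_dyadic_cubes[OF x] mem_cube_at_self[OF x] y])
    finally have d: "max_dist x A \<le> 1 / 2 ^ ?k" .
    have "f x \<le> ereal (- (ln 2 * (S x - 1)))"
    proof (cases "max_dist x A > 0")
      case True
      then have "ln (max_dist x A) \<le> ln (1 / 2 ^ ?k)" using d by (subst ln_le_cancel_iff) auto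
      also have "\<dots> = - (ln 2 * (S x - 1))"
        using pos by (simp add: ln_div ln_realpow Sx of_nat_diff)
      finally show ?thesis using True by (simp add: f_def ext_ln_def)
    qed (simp add: f_def ext_ln_def)
    then show ?thesis using pos Sx by simp
  qed
  have AE_S: "AE x in \<nu>. 0 \<le> ln 2 * (S x - 1)"
    using AE_unit_cube by eventually_elim (use point in auto)
  have int_S: "integrable \<nu> (\<lambda>x. ln 2 * (S x - 1))"
    unfolding S_def by (intro integrable_mult_right Bochner_Integration.integrable_diff integrable_sum_F_cubes) simp
  \<comment> \<open>Almost all distances are at most 1, so the positive part vanishes and
    \<open>ext_integral\<close> involves no difference of infinities.\<close>
  have "(\<integral>\<^sup>+x. e2ennreal (f x) \<partial>\<nu>) = (\<integral>\<^sup>+x. 0 \<partial>\<nu>)"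
    using AE_unit_cube
  proof (intro nn_integral_cong_AE, eventually_elim)
    case (elim x)
    have "f x \<le> ereal (- (ln 2 * (S x - 1)))" "ereal (- (ln 2 * (S x - 1))) \<le> 0"
      using point[OF elim(2)] by auto
    then show "e2ennreal (f x) = 0" by (intro e2ennreal_neg) (rule order_trans)
  qed
  then have pos: "(\<integral>\<^sup>+x. e2ennreal (f x) \<partial>\<nu>) = 0" by simp
  have "(\<integral>x. ln 2 * (S x - 1) \<partial>\<nu>) = ln 2 * (F_fun \<nu> u - 1)"
    using integrable_sum_F_cubes by (simp add: S_def integral_sum_F_cubes prob_space)
  then have "ennreal (ln 2 * (F_fun \<nu> u - 1)) = (\<integral>\<^sup>+x. ennreal (ln 2 * (S x - 1)) \<partial>\<nu>)"
    using nn_integral_eq_integral[OF int_S AE_S] by simp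
  also have "\<dots> \<le> (\<integral>\<^sup>+x. e2ennreal (- f x) \<partial>\<nu>)"
    using AE_unit_cube
  proof (intro nn_integral_mono_AE, eventually_elim)
    case (elim x)
    have "ereal (ln 2 * (S x - 1)) \<le> - f x"
      using point[OF elim(2)] by (cases "f x") auto
    then show "ennreal (ln 2 * (S x - 1)) \<le> e2ennreal (- f x)"
      using e2ennreal_mono by fastforce
  qed
  finally have "enn2ereal (ennreal (ln 2 * (F_fun \<nu> u - 1))) \<le> enn2ereal (\<integral>\<^sup>+x. e2ennreal (- f x) \<partial>\<nu>)"
    by (simp add: less_eq_ennreal.rep_eq)
  \<comment> \<open>Only an inequality is claimed: \<open>ennreal\<close> truncates a negative
    argument to 0.\<close>
  moreover have "ereal (ln 2 * (F_fun \<nu> u - 1)) \<le> enn2ereal (ennreal (ln 2 * (F_fun \<nu> u - 1)))"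
    by (cases "0 \<le> ln 2 * (F_fun \<nu> u - 1)") (auto simp del: zero_le_mult_iff simp: ennreal_neg zero_ennreal.rep_eq)
  ultimately have "ereal (ln 2 * (F_fun \<nu> u - 1)) \<le> enn2ereal (\<integral>\<^sup>+x. e2ennreal (- f x) \<partial>\<nu>)"
    by (rule order_trans[rotated])
  then have "ext_integral \<nu> f \<le> ereal (ln 2 * (- (F_fun \<nu> u - 1)))"
    unfolding ext_integral_def pos
    by (cases "enn2ereal (\<integral>\<^sup>+x. e2ennreal (- f x) \<partial>\<nu>)") (auto simp: zero_ennreal.rep_eq right_diff_distrib)
  then have "ext_exp (ext_integral \<nu> f) \<le> ext_exp (ereal (ln 2 * (- (F_fun \<nu> u - 1))))"
    by (rule ext_exp_mono)
  moreover have "quant_error N \<nu> \<le> ext_exp (ext_integral \<nu> f)"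
    unfolding quant_error_def f_def using finA neA cardA
    by (intro INF_lower) (auto simp: Suc_le_eq card_gt_0_iff)
  ultimately have "quant_error N \<nu> \<le> ext_exp (ereal (ln 2 * (- (F_fun \<nu> u - 1))))"
    by (rule order_trans[rotated])
  then have "ext_log2 (quant_error N \<nu>) \<le> ereal (- (F_fun \<nu> u - 1))"
    using ext_log2_mono ext_log2_ext_exp by metis
  then show ?thesis using ereal_minus_le_minus by fastforce
qed

text \<open>The sets where \<open>d(x,A)\<close> is much smaller than the side length of the cube
  of \<open>x\<close> in the stopping partition are covered by few cubes of mass below \<open>2 powr (- u)\<close>.\<close>

definition near_cubes :: "real \<Rightarrow> (real ^ 'n) set \<Rightarrow> nat \<Rightarrow> (real ^ 'n) set set" where
  "near_cubes u A s = (\<Union>k\<in>{..nat \<lfloor>max_level u\<rfloor>}. \<Union>y\<in>A.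
     {R \<in> dyadic_cubes (k + s). (\<exists>x\<in>R. infnorm (x - y) < 1 / 2 ^ (k + s)) \<and> measure \<nu> R < 2 powr (- u)})"

text \<open>One factor each for the possible generations k, the points of \<open>A\<close>, and the
  neighbouring cubes of a point.\<close>

lemma card_near_cubes:
  assumes "finite A" "0 \<le> u"
  shows "real (card (near_cubes u A s)) \<le> (max_level u + 1) * (real (card A) * 3 ^ CARD('n))"
proof -
  have 1: "card {R \<in> dyadic_cubes (k + s). (\<exists>x\<in>R. infnorm (x - y) < 1 / 2 ^ (k + s)) \<and> measure \<nu> R < 2 powr (- u)}
      \<le> 3 ^ CARD('n)" for k and y :: "real ^ 'n"
    by (rule order_trans[OF card_mono card_dyadic_cubes_near[of "k + s" y]])
       (auto intro: finite_subset[OF _ finite_dyadic_cubes])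
  have 2: "card (\<Union>y\<in>A. {R \<in> dyadic_cubes (k + s).
      (\<exists>x\<in>R. infnorm (x - y) < 1 / 2 ^ (k + s)) \<and> measure \<nu> R < 2 powr (- u)}) \<le> card A * 3 ^ CARD('n)" for k
    by (rule order_trans[OF card_UN_le[OF assms(1)]]) (metis (no_types, lifting) 1 sum_bounded_above of_nat_id)
  have "card (near_cubes u A s) \<le> card {..nat \<lfloor>max_level u\<rfloor>} * (card A * 3 ^ CARD('n))"
    unfolding near_cubes_def
    by (rule order_trans[OF card_UN_le]) (simp, metis (no_types, lifting) 2 sum_bounded_above of_nat_id)
  then have "real (card (near_cubes u A s)) \<le> real (Suc (nat \<lfloor>max_level u\<rfloor>) * (card A * 3 ^ CARD('n)))"
    by (simp only: of_nat_le_iff card_atMost)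
  also have "\<dots> = (real (nat \<lfloor>max_level u\<rfloor>) + 1) * (real (card A) * 3 ^ CARD('n))"
    by (simp add: distrib_right)
  also have "\<dots> \<le> (max_level u + 1) * (real (card A) * 3 ^ CARD('n))"
    using assms log_C_nonneg a_pos
    by (intro mult_right_mono add_right_mono of_nat_floor) (auto simp: max_level_def)
  finally show ?thesis .
qed

lemma finite_near_cubes: "finite A \<Longrightarrow> finite (near_cubes u A s)"
  unfolding near_cubes_def by (auto intro: finite_subset[OF _ finite_dyadic_cubes])

text \<open>A union bound in which each mass is estimated by interpolating the threshold and the
  decay. The result is geometric in \<open>s\<close> with ratio
  \<open>2 powr (- a * e)\<close>.\<close>

lemma emeasure_near_cubes:
  assumes A: "finite A" "card A \<le> N" and u: "0 \<le> u" and e: "0 < e" "e < 1"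
  shows "emeasure \<nu> (\<Union> (near_cubes u A s)) \<le>
    ennreal ((max_level u + 1) * (real N * 3 ^ CARD('n)) * (2 powr (- u * (1 - e)) * C powr e) * (2 powr (- a * e)) ^ s)"
proof -
  have sets: "R \<in> sets \<nu>" if "R \<in> near_cubes u A s" for R
    using that sets_cube by (auto simp: near_cubes_def)
  have ml: "0 \<le> max_level u" using u log_C_nonneg a_pos by (simp add: max_level_def)
  have "measure \<nu> (\<Union> (near_cubes u A s)) \<le> (\<Sum>R\<in>near_cubes u A s. measure \<nu> R)"
    using measure_subadditive_finite[OF finite_near_cubes[OF A(1), of u s], of "\<lambda>R. R" \<nu>] sets
    by (simp add: emeasure_eq_measure subset_iff)
  also have "\<dots> \<le> real (card (near_cubes u A s)) * ((2 powr (- u)) powr (1 - e) * (C * 2 powr (- a * real s)) powr e)"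
  proof (rule sum_bounded_above)
    fix R assume "R \<in> near_cubes u A s"
    then obtain k where k: "R \<in> dyadic_cubes (k + s)" "measure \<nu> R < 2 powr (- u)"
      by (auto simp: near_cubes_def)
    have "measure \<nu> R \<le> C * 2 powr (- a * real (k + s))" by (rule mass_decay[OF k(1)])
    \<comment> \<open>Dropping k makes the bound the same for all generations in the union.\<close>
    also have "\<dots> \<le> C * 2 powr (- a * real s)"
    proof (rule mult_left_mono, rule powr_mono)
      show "- a * real (k + s) \<le> - a * real s"
        using a_pos by (intro mult_left_mono_neg) auto
    qed (use C_ge_1 in auto)
    finally show "measure \<nu> R \<le> (2 powr (- u)) powr (1 - e) * (C * 2 powr (- a * real s)) powr e"
      using k e by (intro le_powr_mult_powr) auto
  qed
  also have "\<dots> = real (card (near_cubes u A s)) * (2 powr (- u * (1 - e)) * C powr e * (2 powr (- a * e)) ^ s)"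
    using C_ge_1 by (simp add: powr_powr powr_mult powr_realpow[symmetric] mult_ac)
  also have "\<dots> \<le> (max_level u + 1) * (real (card A) * 3 ^ CARD('n)) * (2 powr (- u * (1 - e)) * C powr e * (2 powr (- a * e)) ^ s)"
    using card_near_cubes[OF A(1) u] by (intro mult_right_mono) auto
  also have "\<dots> \<le> (max_level u + 1) * (real N * 3 ^ CARD('n)) * (2 powr (- u * (1 - e)) * C powr e * (2 powr (- a * e)) ^ s)"
    using A(2) ml by (intro mult_right_mono mult_left_mono) auto
  finally show ?thesis by (simp add: emeasure_eq_measure mult.assoc ennreal_leI)
qed

text \<open>The cube of \<open>x\<close> lying \<open>s\<close> generations below its stopping cube
  is light, being contained in it, and \<open>x\<close> itself witnesses that it is close to a
  nearest point of \<open>A\<close>.\<close>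

lemma mem_near_cubes:
  assumes A: "finite A" "A \<noteq> {}" and x: "x \<in> cbox 0 1" and u: "0 \<le> u"
    and d: "max_dist x A < 1 / 2 ^ (level u x + s)"
  shows "x \<in> \<Union> (near_cubes u A s)"
proof -
  obtain y where y: "y \<in> A" "max_dist x A = infnorm (x - y)" using max_dist_attained[OF A] .
  let ?R = "cube_at (level u x + s) x"
  have "cube_at (level u x) x \<notin> F_cubes \<nu> u" by (simp add: cube_at_F_cubes_iff_level[OF x])
  then have "measure \<nu> (cube_at (level u x) x) < 2 powr (- u)"
    by (simp add: cube_at_F_cubes_iff[OF x])
  moreover have "measure \<nu> ?R \<le> measure \<nu> (cube_at (level u x) x)"
    by (intro finite_measure_mono cube_at_antimono sets_cube[OF cube_at_in_dyadic_cubes[OF x]]) simp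
  ultimately have "measure \<nu> ?R < 2 powr (- u)" by simp
  moreover have "level u x \<le> nat \<lfloor>max_level u\<rfloor>" using level_le[OF x u] by (simp add: le_nat_floor)
  ultimately have "?R \<in> near_cubes u A s"
    unfolding near_cubes_def using y d cube_at_in_dyadic_cubes[OF x] mem_cube_at_self[OF x]
    by (intro UN_I[of "level u x"] UN_I[of y]) auto
  then show ?thesis using mem_cube_at_self[OF x] by blast
qed

text \<open>For positive distance d and k = \<open>level u x\<close>, the excess -log d - k is at
  most the number of s with d < 2^(-k-s), and each such s is counted by an indicator. An infinite
  count makes the claim trivial.\<close>

lemma neg_ext_ln_max_dist_le:
  assumes A: "finite A" "A \<noteq> {}" and x: "x \<in> cbox 0 1" and u: "0 \<le> u"
  shows "e2ennreal (- ext_ln (max_dist x A)) \<le>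
    ennreal (ln 2) * (ennreal (real (level u x)) + (\<Sum>s. indicator (\<Union> (near_cubes u A s)) x))"
    (is "_ \<le> _ * (_ + ?S)")
proof (cases "?S = \<top>")
  case False
  have lower: "of_nat n \<le> ?S" if "\<And>s. s < n \<Longrightarrow> max_dist x A < 1 / 2 ^ (level u x + s)" for n
  proof -
    have "of_nat n = (\<Sum>s<n. indicator (\<Union> (near_cubes u A s)) x :: ennreal)"
      using mem_near_cubes[OF A x u that] by (simp add: indicator_def)
    also have "\<dots> \<le> ?S" by (rule sum_le_suminf) auto
    finally show ?thesis .
  qed
  obtain n where n: "?S < of_nat n" using False ennreal_Ex_less_of_nat top.not_eq_extremum by metis
  \<comment> \<open>Distance 0 would put \<open>x\<close> into every near set and make the count
    infinite.\<close>
  have pos: "max_dist x A > 0"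
  proof (rule ccontr)
    assume "\<not> 0 < max_dist x A"
    then have "max_dist x A < 1 / 2 ^ (level u x + s)" for s
      by (meson le_less_trans not_less zero_less_divide_1_iff zero_less_numeral zero_less_power)
    then show False using lower[of n] n by simp
  qed
  \<comment> \<open>This may be negative; then \<open>ennreal r\<close> and \<open>nat\<close> of
    its ceiling are 0, and the estimate still holds.\<close>
  define r where "r = - log 2 (max_dist x A) - real (level u x)"
  have "ennreal r \<le> of_nat (nat \<lceil>r\<rceil>)"
    by (metis ennreal_leI ennreal_of_nat_eq_real_of_nat of_nat_ceiling)
  also have "\<dots> \<le> ?S"
  proof (rule lower)
    fix s assume "s < nat \<lceil>r\<rceil>"
    then have "real s < r" by linarith
    then have "log 2 (max_dist x A) < - real (level u x + s)" by (simp add: r_def)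
    then have "max_dist x A < 2 powr (- real (level u x + s))" using pos by (simp add: log_less_iff)
    then show "max_dist x A < 1 / 2 ^ (level u x + s)"
      by (simp add: powr_minus_divide powr_realpow del: of_nat_add)
  qed
  finally have "ennreal (real (level u x)) + ennreal r \<le> ennreal (real (level u x)) + ?S"
    by (rule add_left_mono)
  moreover have "ennreal (real (level u x) + r) \<le> ennreal (real (level u x)) + ennreal r"
    by (cases "0 \<le> r") (auto simp: ennreal_neg ennreal_leI)
  ultimately have "ennreal (real (level u x) + r) \<le> ennreal (real (level u x)) + ?S"
    by (rule order_trans[rotated])
  then have "ennreal (ln 2) * ennreal (real (level u x) + r) \<le> ennreal (ln 2) * (ennreal (real (level u x)) + ?S)"
    by (rule mult_left_mono) simp
  moreover have "e2ennreal (- ext_ln (max_dist x A)) = ennreal (ln 2) * ennreal (real (level u x) + r)"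
    using pos by (simp add: ext_ln_def r_def log_def flip: ennreal_mult')
  ultimately show ?thesis by simp
qed (simp add: ennreal_mult_top)

text \<open>Collects what does not depend on \<open>u\<close> or \<open>N\<close>: the neighbour
  count, the interpolated constant \<open>C\<close>, and the value of the geometric series over
  s.\<close>

definition quant_const :: "real \<Rightarrow> real" where
  "quant_const e = 3 ^ CARD('n) * C powr e / (1 - 2 powr (- a * e))"

text \<open>Integrate the pointwise bound for an arbitrary competitor \<open>A\<close> and sum the
  measures of the near sets. The bound depends on \<open>A\<close> only through \<open>N\<close>, so
  it survives the infimum.\<close>

lemma neg_ext_log2_quant_error_le:
  assumes u: "0 \<le> u" and e: "0 < e" "e < 1"
  shows "- ext_log2 (quant_error N \<nu>) \<le>
    ereal (F_fun \<nu> u + real N * (max_level u + 1) * 2 powr (- u * (1 - e)) * quant_const e)"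
proof -
  define r where "r = 2 powr (- a * e)"
  have r: "0 \<le> r" "r < 1" using a_pos e by (auto simp: r_def powr_less_one)
  define c where "c = (max_level u + 1) * (real N * 3 ^ CARD('n)) * (2 powr (- u * (1 - e)) * C powr e)"
  have c: "0 \<le> c" using u log_C_nonneg a_pos by (simp add: c_def max_level_def)
  define b where "b = c / (1 - r)"
  have b: "0 \<le> b" using c r by (simp add: b_def)
  have bound: "ereal (ln 2 * (- (F_fun \<nu> u + b))) \<le> ext_integral \<nu> (\<lambda>x. ext_ln (max_dist x A))"
    if A: "finite A" "1 \<le> card A" "card A \<le> N" for A
  proof -
    have ne: "A \<noteq> {}" using A by auto
    have sets: "\<Union> (near_cubes u A s) \<in> sets \<nu>" for s
      using finite_near_cubes[OF A(1)] sets_cube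
      by (intro sets.finite_Union) (auto simp: near_cubes_def)
    define S where "S x = (\<Sum>R\<in>F_cubes \<nu> u. indicator R x :: real)" for x
    have S_meas: "(\<lambda>x. ennreal (S x)) \<in> borel_measurable \<nu>"
      using borel_measurable_integrable[OF integrable_sum_F_cubes] by (simp add: S_def)
    have ind_meas: "(\<lambda>x. indicator (\<Union> (near_cubes u A s)) x :: ennreal) \<in> borel_measurable \<nu>" for s
      using sets by simp
    have "(\<integral>\<^sup>+x. e2ennreal (- ext_ln (max_dist x A)) \<partial>\<nu>) \<le>
       (\<integral>\<^sup>+x. ennreal (ln 2) * (ennreal (S x) + (\<Sum>s. indicator (\<Union> (near_cubes u A s)) x)) \<partial>\<nu>)"
      using AE_unit_cube
    proof (intro nn_integral_mono_AE, eventually_elim)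
      case (elim x)
      show ?case using neg_ext_ln_max_dist_le[OF A(1) ne elim(2) u] by (simp only: S_def level_eq_sum[OF elim(2)])
    qed
    also have "\<dots> = ennreal (ln 2) * ((\<integral>\<^sup>+x. ennreal (S x) \<partial>\<nu>) + (\<integral>\<^sup>+x. (\<Sum>s. indicator (\<Union> (near_cubes u A s)) x) \<partial>\<nu>))"
      using S_meas ind_meas by (subst nn_integral_cmult) (auto intro!: nn_integral_add arg_cong2[where f = times])
    also have "(\<integral>\<^sup>+x. ennreal (S x) \<partial>\<nu>) = ennreal (F_fun \<nu> u)"
      unfolding nn_integral_level[symmetric] using AE_level[of u]
      by (intro nn_integral_cong_AE) (auto simp: S_def)
    also have "(\<integral>\<^sup>+x. (\<Sum>s. indicator (\<Union> (near_cubes u A s)) x) \<partial>\<nu>) = (\<Sum>s. emeasure \<nu> (\<Union> (near_cubes u A s)))"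
      using ind_meas sets by (subst nn_integral_suminf) auto
    also have "\<dots> \<le> (\<Sum>s. ennreal (c * r ^ s))"
      by (intro suminf_le emeasure_near_cubes[OF A(1,3) u e, folded c_def r_def]) auto
    also have "\<dots> = ennreal b"
      unfolding b_def using c r sums_mult[OF geometric_sums[of r], of c]
      by (intro suminf_ennreal_eq) auto
    finally have "(\<integral>\<^sup>+x. e2ennreal (- ext_ln (max_dist x A)) \<partial>\<nu>) \<le> ennreal (ln 2 * (F_fun \<nu> u + b))"
      using F_fun_nonneg b by (simp add: ennreal_mult add_left_mono mult_left_mono)
    then have "enn2ereal (\<integral>\<^sup>+x. e2ennreal (- ext_ln (max_dist x A)) \<partial>\<nu>) \<le> ereal (ln 2 * (F_fun \<nu> u + b))"
      using F_fun_nonneg b by (simp add: less_eq_ennreal.rep_eq)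
    \<comment> \<open>Large distances only raise the integral, so the positive part may be replaced
      by 0.\<close>
    moreover have "0 \<le> enn2ereal (\<integral>\<^sup>+x. e2ennreal (ext_ln (max_dist x A)) \<partial>\<nu>)" by simp
    ultimately have "0 - ereal (ln 2 * (F_fun \<nu> u + b)) \<le> ext_integral \<nu> (\<lambda>x. ext_ln (max_dist x A))"
      unfolding ext_integral_def by (intro ereal_minus_mono)
    then show ?thesis by (simp only: mult_minus_right) simp
  qed
  have "ext_exp (ereal (ln 2 * (- (F_fun \<nu> u + b)))) \<le> quant_error N \<nu>"
    unfolding quant_error_def by (intro INF_greatest ext_exp_mono bound) auto
  then have "ereal (- (F_fun \<nu> u + b)) \<le> ext_log2 (quant_error N \<nu>)"
    using ext_log2_mono ext_log2_ext_exp by metis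
  then have "- ext_log2 (quant_error N \<nu>) \<le> ereal (F_fun \<nu> u + b)"
    using ereal_uminus_le_reorder by fastforce
  moreover have "b = real N * (max_level u + 1) * 2 powr (- u * (1 - e)) * quant_const e"
    by (simp add: b_def c_def r_def quant_const_def)
  ultimately show ?thesis by simp
qed

end

section \<open>The Dirichlet series of the cube masses\<close>

text \<open>Lets sums over cubes be handled as integrals for the counting measure, to which Tonelli
  and changes of variables apply.\<close>

lemma nn_integral_count_space_eq_infsum:
  fixes f :: "'a \<Rightarrow> real"
  assumes "\<And>x. x \<in> A \<Longrightarrow> 0 \<le> f x" "f summable_on A"
  shows "(\<integral>\<^sup>+x. ennreal (f x) \<partial>count_space A) = ennreal (infsum f A)"
proof -
  have "(\<lambda>x. norm (f x)) summable_on A"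
    using assms by (subst summable_on_cong[of A _ f]) auto
  then have abs: "Infinite_Set_Sum.abs_summable_on f A"
    using abs_summable_equivalent by blast
  show ?thesis
    unfolding infsetsum_infsum[OF abs, symmetric] by (rule nn_integral_conv_infsetsum[OF abs assms(1)])
qed

context dyadic_mass
begin

text \<open>The position on the real axis of the contribution of \<open>Q\<close> to dF.\<close>

definition log_mass :: "(real ^ 'n) set \<Rightarrow> real" where
  "log_mass Q = - log 2 (measure \<nu> Q)"

lemma log_mass_nonneg: "Q \<in> mass_cubes \<nu> \<Longrightarrow> 0 \<le> log_mass Q"
  unfolding log_mass_def mass_cubes_def using prob_le_1[of Q] by auto

lemma F_cubes_eq: "F_cubes \<nu> u = {Q \<in> mass_cubes \<nu>. log_mass Q \<le> u}"
  by (simp add: F_cubes_def log_mass_def)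

lemma powr_log_mass:
  assumes "Q \<in> mass_cubes \<nu>"
  shows "2 powr (- s * log_mass Q) = measure \<nu> Q powr s"
proof -
  have "measure \<nu> Q powr s = (2 powr log 2 (measure \<nu> Q)) powr s"
    using assms by (simp add: mass_cubes_def)
  also have "\<dots> = 2 powr (- s * log_mass Q)"
    unfolding powr_powr by (simp add: log_mass_def mult.commute)
  finally show ?thesis by simp
qed

lemma measure_powr_eq:
  "Q \<in> mass_cubes \<nu> \<Longrightarrow> measure \<nu> Q powr (1 + s) = measure \<nu> Q * measure \<nu> Q powr s"
  by (simp add: mass_cubes_def powr_add)

lemma countable_mass_cubes: "countable (mass_cubes \<nu>)"
  by (rule countable_subset[OF _ countable_all_dyadic_cubes]) (auto simp: mass_cubes_def)

text \<open>Split off one factor of the mass: these factors sum to at most 1 over a generation, and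
  the remaining power \<open>q - 1\<close> is bounded by the decay.\<close>

lemma sum_powr_generation_le:
  assumes "1 < q"
  shows "(\<Sum>Q\<in>dyadic_cubes k \<inter> mass_cubes \<nu>. measure \<nu> Q powr q) \<le> C powr (q - 1) * (2 powr (- a * (q - 1))) ^ k"
proof -
  have "measure \<nu> Q powr q \<le> measure \<nu> Q * (C powr (q - 1) * (2 powr (- a * (q - 1))) ^ k)"
    if Q: "Q \<in> dyadic_cubes k" for Q
  proof -
    have "measure \<nu> Q powr q = measure \<nu> Q * measure \<nu> Q powr (q - 1)"
      using assms by (cases "measure \<nu> Q = 0") (auto simp: powr_mult_base zero_less_measure_iff)
    also have "measure \<nu> Q powr (q - 1) \<le> (C * 2 powr (- a * real k)) powr (q - 1)"
      using mass_decay[OF Q] assms by (intro powr_mono2) auto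
    also have "\<dots> = C powr (q - 1) * (2 powr (- a * (q - 1))) ^ k"
      using C_ge_1 by (simp add: powr_mult powr_powr powr_realpow[symmetric] mult_ac)
    finally show ?thesis by (simp add: mult_left_mono)
  qed
  then have "(\<Sum>Q\<in>dyadic_cubes k \<inter> mass_cubes \<nu>. measure \<nu> Q powr q) \<le>
      (\<Sum>Q\<in>dyadic_cubes k \<inter> mass_cubes \<nu>. measure \<nu> Q * (C powr (q - 1) * (2 powr (- a * (q - 1))) ^ k))"
    by (intro sum_mono) auto
  also have "\<dots> = (\<Sum>Q\<in>dyadic_cubes k \<inter> mass_cubes \<nu>. measure \<nu> Q) * (C powr (q - 1) * (2 powr (- a * (q - 1))) ^ k)"
    by (simp add: sum_distrib_right)
  also have "\<dots> \<le> 1 * (C powr (q - 1) * (2 powr (- a * (q - 1))) ^ k)"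
  proof (rule mult_right_mono)
    have "(\<Sum>Q\<in>dyadic_cubes k \<inter> mass_cubes \<nu>. measure \<nu> Q) \<le> (\<Sum>Q\<in>dyadic_cubes k. measure \<nu> Q)"
      by (rule sum_mono2) (auto simp: finite_dyadic_cubes)
    then show "(\<Sum>Q\<in>dyadic_cubes k \<inter> mass_cubes \<nu>. measure \<nu> Q) \<le> 1"
      by (simp only: sum_measure_dyadic_cubes)
  qed simp
  finally show ?thesis by simp
qed

lemma sum_over_generations:
  "sum f (\<Union>k<n. dyadic_cubes k \<inter> mass_cubes \<nu>) = (\<Sum>k<n. sum f (dyadic_cubes k \<inter> mass_cubes \<nu>))"
  by (rule sum.UNION_disjoint) (auto simp: finite_dyadic_cubes dest: dyadic_cubes_generation_unique)

lemma finite_mass_cubes_subset: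
  assumes "finite B" "B \<subseteq> mass_cubes \<nu>"
  obtains n where "B \<subseteq> (\<Union>k<n. dyadic_cubes k \<inter> mass_cubes \<nu>)"
proof -
  have "\<forall>Q\<in>B. \<exists>k. Q \<in> dyadic_cubes k" using assms by (auto simp: mass_cubes_def all_dyadic_cubes_def)
  then obtain g where g: "\<And>Q. Q \<in> B \<Longrightarrow> Q \<in> dyadic_cubes (g Q)" by metis
  obtain n where n: "\<And>Q. Q \<in> B \<Longrightarrow> g Q < n"
    using finite_nat_set_iff_bounded[of "g ` B"] assms(1) by auto
  show thesis by (rule that[of n]) (use g n assms in blast)
qed

lemma summable_powr:
  assumes q: "1 < q"
  shows "(\<lambda>Q. measure \<nu> Q powr q) summable_on mass_cubes \<nu>"
proof (rule nonneg_bdd_above_summable_on)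
  let ?r = "2 powr (- a * (q - 1))"
  have r: "0 \<le> ?r" "?r < 1" using a_pos q by (auto simp: powr_less_one)
  have "sum (\<lambda>Q. measure \<nu> Q powr q) B \<le> (\<Sum>k. C powr (q - 1) * ?r ^ k)"
    if B: "finite B" "B \<subseteq> mass_cubes \<nu>" for B
  proof -
    obtain n where n: "B \<subseteq> (\<Union>k<n. dyadic_cubes k \<inter> mass_cubes \<nu>)"
      using finite_mass_cubes_subset[OF B] .
    have "sum (\<lambda>Q. measure \<nu> Q powr q) B \<le> sum (\<lambda>Q. measure \<nu> Q powr q) (\<Union>k<n. dyadic_cubes k \<inter> mass_cubes \<nu>)"
      using n by (intro sum_mono2) (auto simp: finite_dyadic_cubes)
    also have "\<dots> \<le> (\<Sum>k<n. C powr (q - 1) * ?r ^ k)"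
      unfolding sum_over_generations by (intro sum_mono sum_powr_generation_le q)
    also have "\<dots> \<le> (\<Sum>k. C powr (q - 1) * ?r ^ k)"
      using r by (intro sum_le_suminf summable_mult summable_geometric) auto
    finally show ?thesis .
  qed
  then show "bdd_above (sum (\<lambda>Q. measure \<nu> Q powr q) ` {F. F \<subseteq> mass_cubes \<nu> \<and> finite F})"
    by (intro bdd_aboveI2) auto
qed simp

text \<open>Every finite set of cubes lies in finitely many generations, so the partial sums by
  generation are cofinal among the finite partial sums that define \<open>Z_sum\<close>.\<close>

lemma Z_sum_sums:
  assumes q: "1 < q"
  shows "(\<lambda>k. \<Sum>Q\<in>dyadic_cubes k \<inter> mass_cubes \<nu>. measure \<nu> Q powr q) sums Z_sum \<nu> q"
proof -
  let ?B = "\<lambda>n. \<Union>k<n. dyadic_cubes k \<inter> mass_cubes \<nu>"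
  have "filterlim ?B (finite_subsets_at_top (mass_cubes \<nu>)) sequentially"
    unfolding filterlim_finite_subsets_at_top
  proof safe
    fix X assume X: "finite X" "X \<subseteq> mass_cubes \<nu>"
    obtain n where n: "X \<subseteq> ?B n" using finite_mass_cubes_subset[OF X] .
    show "\<forall>\<^sub>F m in sequentially. finite (?B m) \<and> X \<subseteq> ?B m \<and> ?B m \<subseteq> mass_cubes \<nu>"
      using eventually_ge_at_top[of n]
    proof eventually_elim
      case (elim m)
      then have "?B n \<subseteq> ?B m" by (intro UN_mono) auto
      then show ?case using n finite_Int[OF disjI1[OF finite_dyadic_cubes]] by (auto simp del: UN_simps)
    qed
  qed
  moreover have "(sum (\<lambda>Q. measure \<nu> Q powr q) \<longlongrightarrow> Z_sum \<nu> q) (finite_subsets_at_top (mass_cubes \<nu>))"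
    unfolding Z_sum_def using has_sum_infsum[OF summable_powr[OF q]] by (simp add: has_sum_def)
  ultimately have "(\<lambda>n. sum (\<lambda>Q. measure \<nu> Q powr q) (?B n)) \<longlonglongrightarrow> Z_sum \<nu> q"
    by (rule filterlim_compose[rotated])
  then show ?thesis unfolding sums_def sum_over_generations .
qed

lemma nn_integral_count_space_mass:
  assumes "finite {Q \<in> mass_cubes \<nu>. log_mass Q \<in> S}"
  shows "(\<integral>\<^sup>+Q. ennreal (measure \<nu> Q) * indicator S (log_mass Q) \<partial>count_space (mass_cubes \<nu>)) =
    ennreal (\<Sum>Q\<in>{Q \<in> mass_cubes \<nu>. log_mass Q \<in> S}. measure \<nu> Q)"
proof -
  have "(\<integral>\<^sup>+Q. ennreal (measure \<nu> Q) * indicator S (log_mass Q) \<partial>count_space (mass_cubes \<nu>)) =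
     (\<Sum>Q\<in>{Q \<in> mass_cubes \<nu>. log_mass Q \<in> S}. ennreal (measure \<nu> Q) * indicator S (log_mass Q))"
    using assms by (intro nn_integral_count_space') auto
  also have "\<dots> = (\<Sum>Q\<in>{Q \<in> mass_cubes \<nu>. log_mass Q \<in> S}. ennreal (measure \<nu> Q))"
    by (intro sum.cong) auto
  finally show ?thesis by (simp add: sum_ennreal)
qed

section \<open>The Lebesgue-Stieltjes measure of F\<close>

lemma F_fun_eq_nn_integral:
  "ennreal (F_fun \<nu> u) = (\<integral>\<^sup>+Q. ennreal (measure \<nu> Q) * indicator {..u} (log_mass Q) \<partial>count_space (mass_cubes \<nu>))"
  using nn_integral_count_space_mass[of "{..u}"] finite_F_cubes[of u]
  by (simp add: F_cubes_eq F_fun_eq_sum)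

text \<open>The sum over all mass cubes of a point mass \<open>measure \<nu> Q\<close> at
  \<open>log_mass Q\<close>; its distribution function is F.\<close>

definition mass_distr :: "real measure" where
  "mass_distr = distr (density (count_space (mass_cubes \<nu>)) (\<lambda>Q. ennreal (measure \<nu> Q))) borel log_mass"

lemma sets_mass_distr [simp]: "sets mass_distr = sets borel"
  by (simp add: mass_distr_def)

lemma nn_integral_mass_distr:
  assumes "f \<in> borel_measurable borel"
  shows "(\<integral>\<^sup>+u. f u \<partial>mass_distr) = (\<integral>\<^sup>+Q. ennreal (measure \<nu> Q) * f (log_mass Q) \<partial>count_space (mass_cubes \<nu>))"
  unfolding mass_distr_def using assms
  by (subst nn_integral_distr) (auto simp: nn_integral_density)

lemma emeasure_mass_distr:
  assumes "S \<in> sets borel"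
  shows "emeasure mass_distr S = (\<integral>\<^sup>+Q. ennreal (measure \<nu> Q) * indicator S (log_mass Q) \<partial>count_space (mass_cubes \<nu>))"
  using nn_integral_mass_distr[of "indicator S"] assms by simp

lemma F_fun_mono: "x \<le> y \<Longrightarrow> F_fun \<nu> x \<le> F_fun \<nu> y"
  using mono_F_fun by (rule monoD)

lemma emeasure_interval_F:
  "u \<le> v \<Longrightarrow> emeasure (interval_measure (F_fun \<nu>)) {u<..v} = ennreal (F_fun \<nu> v - F_fun \<nu> u)"
  by (rule emeasure_interval_measure_Ioc[OF _ F_fun_mono continuous_F_fun])

text \<open>Both measures agree on half-open intervals, a generating family stable under
  intersections, and are finite on an exhausting sequence. Integrals against dF thereby become sums
  over cubes.\<close>

lemma interval_measure_F_fun: "interval_measure (F_fun \<nu>) = mass_distr"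
proof (rule measure_eqI_generator_eq[where E = "range (\<lambda>(a, b). {a<..b::real})" and \<Omega> = UNIV
      and A = "\<lambda>n. {- real n<..real n}"])
  show "Int_stable (range (\<lambda>(a, b). {a<..b::real}))"
    by (auto simp: Int_stable_def intro!: range_eqI[where x = "(max a b, min c d)" for a b c d])
  show "sets (interval_measure (F_fun \<nu>)) = sigma_sets UNIV (range (\<lambda>(a, b). {a<..b::real}))"
    by (simp add: borel_sigma_sets_Ioc)
  show "sets mass_distr = sigma_sets UNIV (range (\<lambda>(a, b). {a<..b::real}))"
    by (simp add: borel_sigma_sets_Ioc)
  show "(\<Union>n. {- real n<..real n}) = UNIV"
  proof (intro set_eqI iffI UNIV_I)
    fix x :: real
    have "x \<in> {- real (nat \<lceil>\<bar>x\<bar>\<rceil> + 1)<..real (nat \<lceil>\<bar>x\<bar>\<rceil> + 1)}"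
      using real_nat_ceiling_ge[of "\<bar>x\<bar>"] by auto linarith+
    then show "x \<in> (\<Union>n. {- real n<..real n})" by blast
  qed
  show "emeasure (interval_measure (F_fun \<nu>)) {- real n<..real n} \<noteq> \<infinity>" for n
    by (simp add: emeasure_interval_F)
  show "emeasure (interval_measure (F_fun \<nu>)) X = emeasure mass_distr X"
    if X_range: "X \<in> range (\<lambda>(a, b). {a<..b::real})" for X
  proof -
    obtain u v where X: "X = {u<..v}" using X_range by auto
    show ?thesis
    proof (cases "u \<le> v")
      case True
      have sub: "F_cubes \<nu> u \<subseteq> F_cubes \<nu> v" by (rule F_cubes_mono[OF True])
      have *: "{Q \<in> mass_cubes \<nu>. log_mass Q \<in> {u<..v}} = F_cubes \<nu> v - F_cubes \<nu> u"
        by (auto simp: F_cubes_eq)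
      have "emeasure mass_distr {u<..v} = ennreal (\<Sum>Q\<in>F_cubes \<nu> v - F_cubes \<nu> u. measure \<nu> Q)"
        using nn_integral_count_space_mass[of "{u<..v}"] finite_F_cubes
        by (simp only: * emeasure_mass_distr finite_Diff sets.top borel_measurable_const)
           (simp add: emeasure_mass_distr)
      also have "\<dots> = ennreal (F_fun \<nu> v - F_fun \<nu> u)"
        by (simp add: F_fun_eq_sum sum_diff[OF finite_F_cubes sub])
      finally show ?thesis by (simp add: X emeasure_interval_F[OF True])
    next
      case False
      then show ?thesis by (simp add: X)
    qed
  qed
qed auto

text \<open>No cube has mass above 1, so nothing lies to the left of 0 and the atom is all of F(0),
  the contribution of the cubes of full mass.\<close>

lemma emeasure_atom_0: "emeasure (interval_measure (F_fun \<nu>)) {0} = ennreal (F_fun \<nu> 0)"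
proof -
  have "emeasure mass_distr {0} = ennreal (F_fun \<nu> 0)"
    unfolding F_fun_eq_nn_integral
  proof (subst emeasure_mass_distr)
    have "indicator {0} (log_mass Q) = (indicator {..0} (log_mass Q) :: ennreal)" if "Q \<in> mass_cubes \<nu>" for Q
      using log_mass_nonneg[OF that] by (simp add: indicator_def)
    then show "(\<integral>\<^sup>+Q. ennreal (measure \<nu> Q) * indicator {0} (log_mass Q) \<partial>count_space (mass_cubes \<nu>)) =
        (\<integral>\<^sup>+Q. ennreal (measure \<nu> Q) * indicator {..0} (log_mass Q) \<partial>count_space (mass_cubes \<nu>))"
      by (intro nn_integral_cong) simp
  qed simp
  then show ?thesis by (simp add: interval_measure_F_fun)
qed

lemma nn_integral_Z_sum:
  assumes "0 < s"
  shows "(\<integral>\<^sup>+Q. ennreal (measure \<nu> Q * 2 powr (- s * log_mass Q)) \<partial>count_space (mass_cubes \<nu>)) = ennreal (Z_sum \<nu> (1 + s))"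
proof -
  have "(\<integral>\<^sup>+Q. ennreal (measure \<nu> Q * 2 powr (- s * log_mass Q)) \<partial>count_space (mass_cubes \<nu>)) =
    (\<integral>\<^sup>+Q. ennreal (measure \<nu> Q powr (1 + s)) \<partial>count_space (mass_cubes \<nu>))"
    by (intro nn_integral_cong) (simp only: space_count_space measure_powr_eq powr_log_mass)
  then show ?thesis using assms summable_powr[of "1 + s"]
    by (simp add: nn_integral_count_space_eq_infsum Z_sum_def)
qed

lemma Z_sum_nonneg: "0 \<le> Z_sum \<nu> q"
  unfolding Z_sum_def by (rule infsum_nonneg) simp

lemma nn_integral_interval_F:
  assumes "0 < s"
  shows "(\<integral>\<^sup>+u. ennreal (indicator {0..} u * 2 powr (- s * u)) \<partial>interval_measure (F_fun \<nu>)) = ennreal (Z_sum \<nu> (1 + s))"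
proof -
  have "(\<integral>\<^sup>+u. ennreal (indicator {0..} u * 2 powr (- s * u)) \<partial>interval_measure (F_fun \<nu>)) =
    (\<integral>\<^sup>+Q. ennreal (measure \<nu> Q * 2 powr (- s * log_mass Q)) \<partial>count_space (mass_cubes \<nu>))"
    unfolding interval_measure_F_fun
    by (subst nn_integral_mass_distr) (auto intro!: nn_integral_cong simp: log_mass_nonneg ennreal_mult')
  then show ?thesis using nn_integral_Z_sum[OF assms] by simp
qed

lemma Z_sum_eq_LINT:
  assumes "0 < s"
  shows "set_integrable (interval_measure (F_fun \<nu>)) {0..} (\<lambda>u. 2 powr (- s * u))"
    "Z_sum \<nu> (1 + s) = (LINT u:{0..}|interval_measure (F_fun \<nu>). 2 powr (- s * u))"
proof -
  let ?f = "\<lambda>u::real. indicator {0..} u * 2 powr (- s * u) :: real"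
  have m: "?f \<in> borel_measurable (interval_measure (F_fun \<nu>))" by measurable
  show "set_integrable (interval_measure (F_fun \<nu>)) {0..} (\<lambda>u. 2 powr (- s * u))"
    unfolding set_integrable_def real_scaleR_def
    by (rule integrableI_nn_integral_finite[OF m _ nn_integral_interval_F[OF assms]]) simp
  show "Z_sum \<nu> (1 + s) = (LINT u:{0..}|interval_measure (F_fun \<nu>). 2 powr (- s * u))"
    unfolding set_lebesgue_integral_def real_scaleR_def
    by (subst integral_eq_nn_integral[OF m])
       (simp, simp only: nn_integral_interval_F[OF assms] enn2real_ennreal[OF Z_sum_nonneg])
qed

section \<open>Laplace representation of the Dirichlet series and linear bounds\<close>

lemma nn_integral_exp_tail:
  fixes s w :: real
  assumes "0 < s"
  shows "(\<integral>\<^sup>+u. ennreal (s * exp (- s * u)) * indicator {w..} u \<partial>lborel) = ennreal (exp (- s * w))"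
proof -
  have "(\<integral>\<^sup>+u. ennreal (s * exp (- s * u)) * indicator {w..} u \<partial>lborel) = ennreal (0 - (- exp (- s * w)))"
  proof (rule nn_integral_FTC_atLeast)
    show "((\<lambda>u. - exp (- s * u)) \<longlongrightarrow> 0) at_top"
      using assms by real_asymp
  qed (use assms in \<open>auto intro!: derivative_eq_intros\<close>)
  then show ?thesis by simp
qed

text \<open>The density s e^(-su) on the half line has mean 1/s.\<close>

lemma nn_integral_exp_linear:
  fixes s b :: real
  assumes "0 < s" "0 \<le> b"
  shows "(\<integral>\<^sup>+u. ennreal (s * exp (- s * u) * (b * u)) * indicator {0..} u \<partial>lborel) = ennreal (b / s)"
proof -
  have "(\<integral>\<^sup>+u. ennreal (s * exp (- s * u) * (b * u)) * indicator {0..} u \<partial>lborel) =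
      ennreal (0 - (- b * (0 + 1 / s) * exp (- s * 0)))"
  proof (rule nn_integral_FTC_atLeast)
    show "((\<lambda>u. - b * (u + 1 / s) * exp (- s * u)) \<longlongrightarrow> 0) at_top"
      using assms by real_asymp
    show "((\<lambda>u. - b * (u + 1 / s) * exp (- s * u)) has_real_derivative s * exp (- s * u) * (b * u)) (at u)" for u
      using assms by (auto intro!: derivative_eq_intros simp: field_simps)
  qed (use assms in auto)
  then show ?thesis by simp
qed

text \<open>Tonelli applied to e^(-sv) as the integral of s e^(-su) over u >= v, at v =
  \<open>log_mass Q\<close>. The argument \<open>s / ln 2\<close> converts powers of 2 into
  exponentials.\<close>

lemma Z_sum_laplace:
  assumes s: "0 < s"
  shows "ennreal (Z_sum \<nu> (1 + s / ln 2)) =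
    (\<integral>\<^sup>+u. ennreal (s * exp (- s * u) * F_fun \<nu> u) * indicator {0..} u \<partial>lborel)"
proof -
  have "(\<integral>\<^sup>+u. ennreal (s * exp (- s * u) * F_fun \<nu> u) * indicator {0..} u \<partial>lborel) =
    (\<integral>\<^sup>+u. (\<integral>\<^sup>+Q. ennreal (measure \<nu> Q) * (ennreal (s * exp (- s * u)) * indicator {log_mass Q..} u)
       \<partial>count_space (mass_cubes \<nu>)) \<partial>lborel)"
  proof (rule nn_integral_cong)
    fix u :: real
    have "ennreal (s * exp (- s * u) * F_fun \<nu> u) * indicator {0..} u =
      ennreal (s * exp (- s * u)) * indicator {0..} u *
        (\<integral>\<^sup>+Q. ennreal (measure \<nu> Q) * indicator {..u} (log_mass Q) \<partial>count_space (mass_cubes \<nu>))"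
      unfolding F_fun_eq_nn_integral[symmetric] using s
      by (subst ennreal_mult') (simp_all only: mult_ac, simp_all add: F_fun_nonneg)
    also have "\<dots> = (\<integral>\<^sup>+Q. ennreal (s * exp (- s * u)) * indicator {0..} u *
        (ennreal (measure \<nu> Q) * indicator {..u} (log_mass Q)) \<partial>count_space (mass_cubes \<nu>))"
      by (rule nn_integral_cmult[symmetric]) simp
    also have "\<dots> = (\<integral>\<^sup>+Q. ennreal (measure \<nu> Q) * (ennreal (s * exp (- s * u)) * indicator {log_mass Q..} u)
       \<partial>count_space (mass_cubes \<nu>))"
      \<comment> \<open>As \<open>log_mass Q\<close> is nonnegative, \<open>u >= log_mass Q\<close>
        already contains \<open>u >= 0\<close>.\<close>
      by (rule nn_integral_cong) (auto simp: indicator_def mult_ac dest: log_mass_nonneg)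
    finally show "ennreal (s * exp (- s * u) * F_fun \<nu> u) * indicator {0..} u =
      (\<integral>\<^sup>+Q. ennreal (measure \<nu> Q) * (ennreal (s * exp (- s * u)) * indicator {log_mass Q..} u)
       \<partial>count_space (mass_cubes \<nu>))" .
  qed
  also have "\<dots> = (\<integral>\<^sup>+Q. (\<integral>\<^sup>+u. ennreal (measure \<nu> Q) * (ennreal (s * exp (- s * u)) * indicator {log_mass Q..} u)
       \<partial>lborel) \<partial>count_space (mass_cubes \<nu>))"
    by (rule nn_integral_count_space_nn_integral[OF countable_mass_cubes]) measurable
  also have "\<dots> = (\<integral>\<^sup>+Q. ennreal (measure \<nu> Q * 2 powr (- (s / ln 2) * log_mass Q)) \<partial>count_space (mass_cubes \<nu>))"
  proof (rule nn_integral_cong)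
    fix Q
    have "(\<integral>\<^sup>+u. ennreal (measure \<nu> Q) * (ennreal (s * exp (- s * u)) * indicator {log_mass Q..} u) \<partial>lborel)
      = ennreal (measure \<nu> Q) * ennreal (exp (- s * log_mass Q))"
      by (subst nn_integral_cmult) (auto simp: nn_integral_exp_tail[OF s, simplified])
    also have "\<dots> = ennreal (measure \<nu> Q * 2 powr (- (s / ln 2) * log_mass Q))"
      by (simp add: ennreal_mult powr_def)
    finally show "(\<integral>\<^sup>+u. ennreal (measure \<nu> Q) * (ennreal (s * exp (- s * u)) * indicator {log_mass Q..} u) \<partial>lborel)
      = ennreal (measure \<nu> Q * 2 powr (- (s / ln 2) * log_mass Q))" .
  qed
  also have "\<dots> = ennreal (Z_sum \<nu> (1 + s / ln 2))"
    using s by (intro nn_integral_Z_sum) simp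
  finally show ?thesis by simp
qed

text \<open>Integrate the linear bound against s e^(-su), which has total mass 1 and mean 1/s, then
  multiply by \<open>s\<close>.\<close>

lemma Z_sum_le:
  assumes s: "0 < s" and b: "0 \<le> b" "0 \<le> B" and le: "\<And>u. 0 \<le> u \<Longrightarrow> F_fun \<nu> u \<le> b * u + B"
  shows "s * Z_sum \<nu> (1 + s / ln 2) \<le> b + B * s"
proof -
  have "ennreal (Z_sum \<nu> (1 + s / ln 2)) \<le>
     (\<integral>\<^sup>+u. ennreal (s * exp (- s * u) * (b * u)) * indicator {0..} u + ennreal B * (ennreal (s * exp (- s * u)) * indicator {0..} u) \<partial>lborel)"
    unfolding Z_sum_laplace[OF s]
  proof (rule nn_integral_mono)
    fix u :: real
    show "ennreal (s * exp (- s * u) * F_fun \<nu> u) * indicator {0..} u \<le>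
      ennreal (s * exp (- s * u) * (b * u)) * indicator {0..} u + ennreal B * (ennreal (s * exp (- s * u)) * indicator {0..} u)"
    proof (cases "0 \<le> u")
      case True
      have "s * exp (- s * u) * F_fun \<nu> u \<le> s * exp (- s * u) * (b * u) + B * (s * exp (- s * u))"
        using mult_left_mono[OF le[OF True], of "s * exp (- s * u)"] s by (simp add: algebra_simps)
      then show ?thesis using True s b
        by (simp add: ennreal_leI flip: ennreal_plus ennreal_mult)
    qed simp
  qed
  also have "\<dots> = ennreal (b / s) + ennreal B * ennreal 1"
    using nn_integral_exp_linear[OF s b(1)] nn_integral_exp_tail[OF s, of 0]
    by (subst nn_integral_add) (auto simp: nn_integral_cmult)
  also have "\<dots> = ennreal (b / s + B)" using s b by (simp flip: ennreal_plus)
  finally have "Z_sum \<nu> (1 + s / ln 2) \<le> b / s + B"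
    using s b by (subst (asm) ennreal_le_iff) auto
  then show ?thesis using s by (simp add: field_simps)
qed

text \<open>The constant \<open>B\<close> stays on the side of F so that all integrands are
  nonnegative.\<close>

lemma Z_sum_ge:
  assumes s: "0 < s" and b: "0 \<le> b" "0 \<le> B" and le: "\<And>u. 0 \<le> u \<Longrightarrow> b * u \<le> F_fun \<nu> u + B"
  shows "b \<le> s * Z_sum \<nu> (1 + s / ln 2) + B * s"
proof -
  have [measurable]: "F_fun \<nu> \<in> borel_measurable borel"
    by (rule borel_measurable_mono[OF mono_F_fun])
  have "ennreal (b / s) = (\<integral>\<^sup>+u. ennreal (s * exp (- s * u) * (b * u)) * indicator {0..} u \<partial>lborel)"
    using nn_integral_exp_linear[OF s b(1)] by simp
  also have "\<dots> \<le> (\<integral>\<^sup>+u. ennreal (s * exp (- s * u) * F_fun \<nu> u) * indicator {0..} u + ennreal B * (ennreal (s * exp (- s * u)) * indicator {0..} u) \<partial>lborel)"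
  proof (rule nn_integral_mono)
    fix u :: real
    show "ennreal (s * exp (- s * u) * (b * u)) * indicator {0..} u \<le>
      ennreal (s * exp (- s * u) * F_fun \<nu> u) * indicator {0..} u + ennreal B * (ennreal (s * exp (- s * u)) * indicator {0..} u)"
    proof (cases "0 \<le> u")
      case True
      have "s * exp (- s * u) * (b * u) \<le> s * exp (- s * u) * F_fun \<nu> u + B * (s * exp (- s * u))"
        using mult_left_mono[OF le[OF True], of "s * exp (- s * u)"] s by (simp add: algebra_simps)
      then show ?thesis using True s b F_fun_nonneg
        by (simp add: ennreal_leI flip: ennreal_plus ennreal_mult)
    qed simp
  qed
  also have "\<dots> = ennreal (Z_sum \<nu> (1 + s / ln 2)) + ennreal B * ennreal 1"
    using Z_sum_laplace[OF s] nn_integral_exp_tail[OF s, of 0]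
    by (subst nn_integral_add) (auto simp: nn_integral_cmult)
  also have "\<dots> = ennreal (Z_sum \<nu> (1 + s / ln 2) + B)"
    using Z_sum_nonneg b by (simp flip: ennreal_plus)
  finally have "b / s \<le> Z_sum \<nu> (1 + s / ln 2) + B"
    using Z_sum_nonneg b by (subst (asm) ennreal_le_iff) auto
  then show ?thesis using s by (simp add: field_simps)
qed

end

section \<open>Quantization dimensions and linear growth\<close>

lemma tendsto_linear_mult_powr:
  fixes e p q :: real
  assumes "0 < e"
  shows "((\<lambda>x. (p + q * x) * 2 powr (- e * x)) \<longlongrightarrow> 0) at_top"
proof -
  have "((\<lambda>x::real. 2 powr (- e * x)) \<longlongrightarrow> 0) at_top" "((\<lambda>x::real. x * 2 powr (- e * x)) \<longlongrightarrow> 0) at_top"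
    using assms by real_asymp+
  from tendsto_add[OF tendsto_mult_left[OF this(1), of p] tendsto_mult_left[OF this(2), of q]]
  show ?thesis by (simp add: algebra_simps)
qed

lemma filterlim_log_nat: "filterlim (\<lambda>N. log 2 (real N)) at_top sequentially"
  by real_asymp

context dyadic_mass
begin

definition quant_rate :: "nat \<Rightarrow> ereal" where
  "quant_rate N = - ext_log2 (quant_error N \<nu>)"

text \<open>The assumption on \<open>N\<close> leaves room for one point per heavy cube, whose
  number is bounded through \<open>max_level\<close>.\<close>

lemma quant_rate_ge:
  assumes "0 \<le> u" "2 powr u * max_level u \<le> real N"
  shows "ereal (F_fun \<nu> u - 1) \<le> quant_rate N"
proof -
  have "real (card (F_cubes \<nu> u)) \<le> 2 powr u * F_fun \<nu> u" by (rule card_F_cubes_le)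
  also have "\<dots> \<le> 2 powr u * max_level u" using F_fun_le_max_level[OF assms(1)] by simp
  also have "\<dots> \<le> real N" by (rule assms(2))
  finally show ?thesis unfolding quant_rate_def
    by (intro neg_ext_log2_quant_error_ge assms) simp
qed

text \<open>Interpolation costs one \<open>e\<close> in the exponent; the second \<open>e\<close> in
  the bound on \<open>N\<close> makes the error decay like \<open>2 powr (- e * u)\<close> up to a
  linear factor.\<close>

lemma quant_rate_le:
  assumes "0 \<le> u" "0 < e" "e < 1/2" "real N \<le> 2 powr ((1 - 2 * e) * u)"
  shows "quant_rate N \<le> ereal (F_fun \<nu> u + (max_level u + 1) * 2 powr (- e * u) * quant_const e)"
proof -
  have c: "0 \<le> quant_const e"
    using assms a_pos C_ge_1 by (auto simp: quant_const_def less_imp_le powr_less_one intro!: divide_nonneg_nonneg)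
  have m: "0 \<le> max_level u + 1" using assms(1) log_C_nonneg a_pos by (simp add: max_level_def)
  have "real N * (max_level u + 1) * 2 powr (- u * (1 - e)) * quant_const e =
      (max_level u + 1) * (real N * 2 powr (- u * (1 - e))) * quant_const e" by simp
  also have "\<dots> \<le> (max_level u + 1) * (2 powr ((1 - 2 * e) * u) * 2 powr (- u * (1 - e))) * quant_const e"
    using assms(4) c m by (intro mult_right_mono mult_left_mono) auto
  also have "2 powr ((1 - 2 * e) * u) * 2 powr (- u * (1 - e)) = 2 powr (- e * u)"
    by (simp flip: powr_add) (simp add: algebra_simps)
  finally have "F_fun \<nu> u + real N * (max_level u + 1) * 2 powr (- u * (1 - e)) * quant_const e \<le>
     F_fun \<nu> u + (max_level u + 1) * 2 powr (- e * u) * quant_const e" by simp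
  then show ?thesis unfolding quant_rate_def
    using neg_ext_log2_quant_error_le[OF assms(1,2), of N] assms(3) order_trans by fastforce
qed

lemma tendsto_max_level_powr:
  assumes "0 < e"
  shows "((\<lambda>u. (max_level u + p) * 2 powr (- e * u)) \<longlongrightarrow> 0) at_top"
proof -
  have "max_level u + p = (1 + log 2 C / a + p) + (1 / a) * u" for u
    using a_pos by (simp add: max_level_def field_simps)
  then show ?thesis using tendsto_linear_mult_powr[OF assms] by presburger
qed

lemma eventually_error_le:
  assumes "0 < e" "0 < d"
  shows "\<forall>\<^sub>F u in at_top. (max_level u + 1) * 2 powr (- e * u) * quant_const e \<le> d"
proof -
  have "((\<lambda>u. (max_level u + 1) * 2 powr (- e * u) * quant_const e) \<longlongrightarrow> 0 * quant_const e) at_top"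
    by (intro tendsto_mult_right tendsto_max_level_powr assms)
  then have "\<forall>\<^sub>F u in at_top. (max_level u + 1) * 2 powr (- e * u) * quant_const e < d"
    using assms by (intro order_tendstoD) auto
  then show ?thesis by eventually_elim simp
qed

lemma eventually_max_level_le:
  assumes "0 < e"
  shows "\<forall>\<^sub>F u in at_top. max_level u + p \<le> 2 powr (e * u)"
proof -
  have "\<forall>\<^sub>F u in at_top. (max_level u + p) * 2 powr (- e * u) < 1"
    using tendsto_max_level_powr[OF assms] by (intro order_tendstoD) auto
  then show ?thesis by eventually_elim (simp add: powr_minus field_simps)
qed

text \<open>Generations 0 and 1 each carry total mass 1. The value 2 compensates the loss of 1 and
  leaves a positive quantization rate.\<close>

lemma F_fun_ge_2: "\<exists>u\<ge>0. 2 \<le> F_fun \<nu> u"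
proof -
  let ?B = "\<Union>k<2. dyadic_cubes k \<inter> mass_cubes \<nu>"
  have fin: "finite ?B" using finite_dyadic_cubes by auto
  define u where "u = Max (insert 0 (log_mass ` ?B))"
  have "sum (measure \<nu>) (dyadic_cubes k \<inter> mass_cubes \<nu>) = 1" for k
  proof -
    have "sum (measure \<nu>) (dyadic_cubes k \<inter> mass_cubes \<nu>) = sum (measure \<nu>) (dyadic_cubes k)"
      by (rule sum.mono_neutral_left)
         (auto simp: finite_dyadic_cubes mass_cubes_def all_dyadic_cubes_def zero_less_measure_iff)
    then show ?thesis by (simp add: sum_measure_dyadic_cubes)
  qed
  then have "2 = sum (measure \<nu>) ?B" unfolding sum_over_generations by simp
  also have "\<dots> \<le> sum (measure \<nu>) (F_cubes \<nu> u)"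
  proof (rule sum_mono2[OF finite_F_cubes])
    show "?B \<subseteq> F_cubes \<nu> u"
    proof
      fix Q assume Q: "Q \<in> ?B"
      then have "log_mass Q \<le> u" unfolding u_def using fin by (intro Max_ge) auto
      then show "Q \<in> F_cubes \<nu> u" using Q by (auto simp: F_cubes_eq)
    qed
  qed simp
  finally have "2 \<le> F_fun \<nu> u" by (simp add: F_fun_eq_sum)
  moreover have "0 \<le> u" unfolding u_def using fin by (intro Max_ge) auto
  ultimately show ?thesis by blast
qed

lemma eventually_quant_rate_real:
  "\<forall>\<^sub>F N in sequentially. \<exists>r>0. quant_rate N = ereal r"
proof -
  obtain u where u: "0 \<le> u" "2 \<le> F_fun \<nu> u" using F_fun_ge_2 by blast
  have "\<forall>\<^sub>F N in sequentially. 2 powr u * max_level u \<le> real N"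
    using filterlim_real_sequentially unfolding filterlim_at_top by blast
  then show ?thesis using eventually_ge_at_top[of 1]
  proof eventually_elim
    case (elim N)
    have "1 \<le> ereal (F_fun \<nu> u - 1)" using u(2) by simp
    also have "\<dots> \<le> quant_rate N" by (rule quant_rate_ge[OF u(1) elim(1)])
    finally have "1 \<le> quant_rate N" .
    \<comment> \<open>With \<open>e = 1/4\<close> and \<open>u = 2 * log 2 N\<close> the bound
      \<open>2 powr ((1 - 2 * e) * u)\<close> equals \<open>N\<close>; only finiteness is wanted
      here.\<close>
    moreover have "quant_rate N \<le> ereal (F_fun \<nu> (2 * log 2 (real N)) +
        (max_level (2 * log 2 (real N)) + 1) * 2 powr (- (1 / 4) * (2 * log 2 (real N))) * quant_const (1 / 4))"
      using elim(2) by (intro quant_rate_le) simp_all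
    then have "quant_rate N \<noteq> \<infinity>" by auto
    ultimately show ?case by (cases "quant_rate N") auto
  qed
qed

section \<open>Transfer of eventual linear bounds between F and the quantization rate\<close>

lemma F_fun_le_if_quant_rate_le:
  assumes "0 < b" "b < b'" "\<forall>\<^sub>F N in sequentially. quant_rate N \<le> ereal (b * log 2 (real N))"
  shows "\<forall>\<^sub>F u in at_top. F_fun \<nu> u \<le> b' * u"
proof -
  \<comment> \<open>Makes \<open>b * (1 + e)\<close> the midpoint of \<open>b\<close> and
    \<open>b'\<close>.\<close>
  define e where "e = (b' - b) / (2 * b)"
  have e: "0 < e" "b * (1 + e) < b'" using assms by (auto simp: e_def field_simps)
  define n where "n u = nat \<lceil>2 powr u * max_level u\<rceil>" for u
  have "filterlim (\<lambda>u::real. 2 powr u) at_top at_top" by real_asymp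
  then have "filterlim n at_top at_top"
  proof -
    assume *: "filterlim (\<lambda>u::real. 2 powr u) at_top at_top"
    have "filterlim (\<lambda>u. 2 powr u * max_level u) at_top at_top"
    proof (rule filterlim_at_top_mono[OF *])
      show "\<forall>\<^sub>F u in at_top. 2 powr u \<le> 2 powr u * max_level u"
        using eventually_ge_at_top[of 0]
        by eventually_elim (use log_C_nonneg a_pos in \<open>simp add: max_level_def\<close>)
    qed
    show ?thesis unfolding filterlim_at_top
    proof
      fix m
      have "\<forall>\<^sub>F u in at_top. real m \<le> 2 powr u * max_level u"
        using \<open>filterlim (\<lambda>u. 2 powr u * max_level u) at_top at_top\<close> unfolding filterlim_at_top by blast
      then show "\<forall>\<^sub>F u in at_top. m \<le> n u"
        by eventually_elim (simp add: n_def, linarith)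
    qed
  qed
  then have "\<forall>\<^sub>F u in at_top. quant_rate (n u) \<le> ereal (b * log 2 (real (n u)))"
    using assms(3) by (rule eventually_compose_filterlim[rotated])
  moreover have "\<forall>\<^sub>F u in at_top. max_level u + 1 \<le> 2 powr (e * u)"
    by (rule eventually_max_level_le[OF e(1)])
  moreover have "\<forall>\<^sub>F u in at_top. 1 + b * ((1 + e) * u) \<le> b' * u"
    using e(2) by real_asymp
  ultimately show ?thesis using eventually_ge_at_top[of 0]
  proof eventually_elim
    case (elim u)
    have pos: "1 \<le> 2 powr u * max_level u"
      using ge_one_powr_ge_zero[of 2 u] elim(4) log_C_nonneg a_pos
        mult_mono[of 1 "2 powr u" 1 "max_level u"] by (simp add: max_level_def)
    have "ereal (F_fun \<nu> u - 1) \<le> quant_rate (n u)"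
      using elim by (intro quant_rate_ge) (auto simp: n_def real_nat_ceiling_ge)
    also have "\<dots> \<le> ereal (b * log 2 (real (n u)))" by (rule elim)
    finally have 1: "F_fun \<nu> u \<le> 1 + b * log 2 (real (n u))" by simp
    have n1: "0 < real (n u)" using pos by (simp add: n_def)
    have "real (n u) \<le> 2 powr u * max_level u + 1" using pos by (simp add: n_def)
    also have "\<dots> \<le> 2 powr u * max_level u + 2 powr u" using elim ge_one_powr_ge_zero[of 2 u] by simp
    also have "\<dots> = 2 powr u * (max_level u + 1)" by (simp add: algebra_simps)
    also have "\<dots> \<le> 2 powr u * 2 powr (e * u)" using elim by (intro mult_left_mono) auto
    also have "\<dots> = 2 powr ((1 + e) * u)" by (simp add: algebra_simps flip: powr_add)
    finally have "log 2 (real (n u)) \<le> (1 + e) * u" using n1 by (subst log_le_iff) auto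
    then have "b * log 2 (real (n u)) \<le> b * ((1 + e) * u)" using assms(1) by simp
    then show ?case using 1 elim(3) by linarith
  qed
qed

lemma F_fun_ge_if_quant_rate_ge:
  assumes "0 < b'" "b' < b" "\<forall>\<^sub>F N in sequentially. ereal (b * log 2 (real N)) \<le> quant_rate N"
  shows "\<forall>\<^sub>F u in at_top. b' * u \<le> F_fun \<nu> u"
proof -
  \<comment> \<open>Makes \<open>b * (1 - 2 * e)\<close> the midpoint of \<open>b\<close> and
    \<open>b'\<close>; the factor \<open>1 - 2 * e\<close> comes from
    \<open>quant_rate_le\<close>.\<close>
  define e where "e = (b - b') / (4 * b)"
  have e: "0 < e" "e < 1/2" "b' < b * (1 - 2 * e)" using assms by (auto simp: e_def field_simps)
  define n where "n u = nat \<lfloor>2 powr ((1 - 2 * e) * u)\<rfloor>" for u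
  have "filterlim (\<lambda>u::real. 2 powr ((1 - 2 * e) * u)) at_top at_top" using e(2) by real_asymp
  then have "filterlim n at_top at_top" unfolding n_def
    by (intro filterlim_compose[OF filterlim_nat_sequentially] filterlim_compose[OF filterlim_floor_sequentially])
  then have "\<forall>\<^sub>F u in at_top. ereal (b * log 2 (real (n u))) \<le> quant_rate (n u)"
    using assms(3) by (rule eventually_compose_filterlim[rotated])
  moreover have "\<forall>\<^sub>F u in at_top. (max_level u + 1) * 2 powr (- e * u) * quant_const e \<le> 1"
    by (rule eventually_error_le[OF e(1)]) simp
  moreover have "\<forall>\<^sub>F u in at_top. b' * u \<le> b * ((1 - 2 * e) * u - 1) - 1"
    using e(3) by real_asymp
  ultimately show ?thesis using eventually_ge_at_top[of 0]
  proof eventually_elim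
    case (elim u)
    have ge1: "1 \<le> 2 powr ((1 - 2 * e) * u)" using elim e by (intro ge_one_powr_ge_zero) auto
    then have n1: "1 \<le> \<lfloor>2 powr ((1 - 2 * e) * u)\<rfloor>" by simp
    \<comment> \<open>Rounding down a number that is at least 1 loses at most a factor 2, that is, 1
      in the logarithm.\<close>
    then have n2: "real (n u) \<le> 2 powr ((1 - 2 * e) * u)" "2 powr ((1 - 2 * e) * u) \<le> 2 * real (n u)" "0 < real (n u)"
      unfolding n_def by linarith+
    have "(1 - 2 * e) * u \<le> log 2 (2 * real (n u))"
      using n2 by (subst le_log_iff) auto
    also have "\<dots> = log 2 (real (n u)) + 1" using n2 by (simp add: log_mult)
    finally have "b * ((1 - 2 * e) * u - 1) \<le> b * log 2 (real (n u))" using assms by simp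
    moreover have "ereal (b * log 2 (real (n u))) \<le> ereal (F_fun \<nu> u + (max_level u + 1) * 2 powr (- e * u) * quant_const e)"
      by (rule order_trans[OF elim(1) quant_rate_le]) (use elim e n2 in auto)
    then have "b * log 2 (real (n u)) \<le> F_fun \<nu> u + (max_level u + 1) * 2 powr (- e * u) * quant_const e"
      by simp
    ultimately show ?case using elim(2,3) by linarith
  qed
qed

lemma quant_rate_ge_if_F_fun_ge:
  assumes "0 < b'" "b' < b" "\<forall>\<^sub>F u in at_top. b * u \<le> F_fun \<nu> u"
  shows "\<forall>\<^sub>F N in sequentially. ereal (b' * log 2 (real N)) \<le> quant_rate N"
proof -
  define e where "e = (b - b') / (2 * b)"
  have e: "0 < e" "e < 1" "b' < b * (1 - e)" using assms by (auto simp: e_def field_simps)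
  have lim: "filterlim (\<lambda>N. (1 - e) * log 2 (real N)) at_top sequentially" using e(2) by real_asymp
  \<comment> \<open>At \<open>u = (1 - e) * log 2 N\<close> this exponent bounds
    \<open>max_level u\<close> by N^e, so that \<open>2 powr u * max_level u\<close> is at most
    \<open>N\<close>.\<close>
  have "0 < e / (1 - e)" using e by simp
  from eventually_compose_filterlim[OF eventually_max_level_le[OF this, of 0] lim]
    eventually_compose_filterlim[OF assms(3) lim]
  have "\<forall>\<^sub>F N in sequentially. max_level ((1 - e) * log 2 (real N)) + 0 \<le> 2 powr (e / (1 - e) * ((1 - e) * log 2 (real N)))"
    "\<forall>\<^sub>F N in sequentially. b * ((1 - e) * log 2 (real N)) \<le> F_fun \<nu> ((1 - e) * log 2 (real N))" .
  moreover have "\<forall>\<^sub>F N in sequentially. b' * log 2 (real N) \<le> b * ((1 - e) * log 2 (real N)) - 1"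
  proof -
    have "\<forall>\<^sub>F x in at_top. b' * x \<le> b * ((1 - e) * x) - 1" using e(3) by real_asymp
    then show ?thesis by (rule eventually_compose_filterlim[OF _ filterlim_log_nat])
  qed
  ultimately show ?thesis using eventually_ge_at_top[of 1]
  proof eventually_elim
    case (elim N)
    let ?u = "(1 - e) * log 2 (real N)"
    have u: "0 \<le> ?u" using elim e by simp
    have "2 powr ?u * max_level ?u \<le> 2 powr ?u * 2 powr (e / (1 - e) * ?u)"
      using elim by (intro mult_left_mono) auto
    also have "\<dots> = 2 powr (log 2 (real N))"
    proof -
      have "e / (1 - e) * ?u = e * log 2 (real N)" using e by simp
      then have "?u + e / (1 - e) * ?u = log 2 (real N)" by (simp only: left_diff_distrib)
      then show ?thesis by (simp only: flip: powr_add)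
    qed
    also have "\<dots> = real N" using elim by simp
    finally have "ereal (F_fun \<nu> ?u - 1) \<le> quant_rate N" by (rule quant_rate_ge[OF u])
    moreover have "ereal (b' * log 2 (real N)) \<le> ereal (F_fun \<nu> ?u - 1)" using elim by simp
    ultimately show ?case by (rule order_trans[rotated])
  qed
qed

lemma quant_rate_le_if_F_fun_le:
  assumes "0 < b" "b < b'" "\<forall>\<^sub>F u in at_top. F_fun \<nu> u \<le> b * u"
  shows "\<forall>\<^sub>F N in sequentially. quant_rate N \<le> ereal (b' * log 2 (real N))"
proof -
  \<comment> \<open>Then \<open>b / (1 - 2 * e)\<close> is the harmonic mean of \<open>b\<close> and
    \<open>b'\<close>, hence below \<open>b'\<close>.\<close>
  define e where "e = (b' - b) / (4 * b')"
  have e: "0 < e" "e < 1/2" "b / (1 - 2 * e) < b'" using assms by (auto simp: e_def field_simps)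
  have lim: "filterlim (\<lambda>N. log 2 (real N) / (1 - 2 * e)) at_top sequentially" using e(2) by real_asymp
  from eventually_compose_filterlim[OF eventually_error_le[OF e(1) zero_less_one] lim]
    eventually_compose_filterlim[OF assms(3) lim]
  have "\<forall>\<^sub>F N in sequentially. (max_level (log 2 (real N) / (1 - 2 * e)) + 1) *
      2 powr (- e * (log 2 (real N) / (1 - 2 * e))) * quant_const e \<le> 1"
    "\<forall>\<^sub>F N in sequentially. F_fun \<nu> (log 2 (real N) / (1 - 2 * e)) \<le> b * (log 2 (real N) / (1 - 2 * e))" .
  moreover have "\<forall>\<^sub>F N in sequentially. (b / (1 - 2 * e)) * log 2 (real N) + 1 \<le> b' * log 2 (real N)"
  proof -
    have "\<forall>\<^sub>F x in at_top. (b / (1 - 2 * e)) * x + 1 \<le> b' * x" using e(3) by real_asymp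
    then show ?thesis by (rule eventually_compose_filterlim[OF _ filterlim_log_nat])
  qed
  ultimately show ?thesis using eventually_ge_at_top[of 1]
  proof eventually_elim
    case (elim N)
    let ?u = "log 2 (real N) / (1 - 2 * e)"
    have u: "0 \<le> ?u" using elim e by simp
    have "quant_rate N \<le> ereal (F_fun \<nu> ?u + (max_level ?u + 1) * 2 powr (- e * ?u) * quant_const e)"
      by (rule quant_rate_le[OF u e(1,2)]) (use elim e in simp)
    also have "\<dots> \<le> ereal (b' * log 2 (real N))" using elim by simp
    finally show ?case .
  qed
qed

section \<open>From quantization rates to quantization dimensions\<close>

lemma lower_quant_dim_eq: "lower_quant_dim \<nu> = liminf (\<lambda>N. ereal (log 2 (real N)) / quant_rate N)"
  by (simp add: lower_quant_dim_def quant_rate_def)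

lemma upper_quant_dim_eq: "upper_quant_dim \<nu> = limsup (\<lambda>N. ereal (log 2 (real N)) / quant_rate N)"
  by (simp add: upper_quant_dim_def quant_rate_def)

lemma lower_le_upper_quant_dim: "lower_quant_dim \<nu> \<le> upper_quant_dim \<nu>"
  unfolding lower_quant_dim_eq upper_quant_dim_eq by (rule Liminf_le_Limsup) simp

lemma lower_quant_dim_nonneg: "0 \<le> lower_quant_dim \<nu>"
  unfolding lower_quant_dim_eq
proof (rule Liminf_bounded)
  show "\<forall>\<^sub>F N in sequentially. 0 \<le> ereal (log 2 (real N)) / quant_rate N"
    using eventually_quant_rate_real eventually_ge_at_top[of 1]
    by eventually_elim auto
qed

lemma upper_quant_dim_nonneg: "0 \<le> upper_quant_dim \<nu>"
  using lower_quant_dim_nonneg lower_le_upper_quant_dim by (rule order_trans)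

text \<open>The reciprocal is taken in the extended reals; the case of dimension 0, with reciprocal
  infinity, is included.\<close>

lemma quant_rate_ge_if_upper:
  assumes "0 < b" "ereal b < 1 / upper_quant_dim \<nu>"
  shows "\<forall>\<^sub>F N in sequentially. ereal (b * log 2 (real N)) \<le> quant_rate N"
proof -
  have "upper_quant_dim \<nu> < ereal (1 / b)"
  proof (cases "upper_quant_dim \<nu>")
    case (real r)
    then show ?thesis using assms upper_quant_dim_nonneg
      by (cases "r = 0") (auto simp: field_simps one_ereal_def)
  qed (use assms upper_quant_dim_nonneg in auto)
  then have "\<forall>\<^sub>F N in sequentially. ereal (log 2 (real N)) / quant_rate N < ereal (1 / b)"
    unfolding upper_quant_dim_eq by (rule Limsup_lessD)
  with eventually_quant_rate_real show ?thesis
    by eventually_elim (use assms(1) in \<open>auto simp: field_simps\<close>)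
qed

lemma quant_rate_le_if_lower:
  assumes "0 < b" "1 / lower_quant_dim \<nu> < ereal b"
  shows "\<forall>\<^sub>F N in sequentially. quant_rate N \<le> ereal (b * log 2 (real N))"
proof -
  have "ereal (1 / b) < lower_quant_dim \<nu>"
  proof (cases "lower_quant_dim \<nu>")
    case (real r)
    then show ?thesis using assms lower_quant_dim_nonneg
      by (cases "r = 0") (auto simp: field_simps one_ereal_def)
  qed (use assms lower_quant_dim_nonneg in auto)
  then have "\<forall>\<^sub>F N in sequentially. ereal (1 / b) < ereal (log 2 (real N)) / quant_rate N"
    unfolding lower_quant_dim_eq by (rule less_LiminfD)
  with eventually_quant_rate_real show ?thesis
    by eventually_elim (use assms(1) in \<open>auto simp: field_simps\<close>)
qed

lemma upper_quant_dim_le: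
  assumes "0 < b" "\<forall>\<^sub>F N in sequentially. ereal (b * log 2 (real N)) \<le> quant_rate N"
  shows "upper_quant_dim \<nu> \<le> ereal (1 / b)"
  unfolding upper_quant_dim_eq
proof (rule Limsup_bounded)
  show "\<forall>\<^sub>F N in sequentially. ereal (log 2 (real N)) / quant_rate N \<le> ereal (1 / b)"
    using assms(2) eventually_quant_rate_real
    by eventually_elim (use assms(1) in \<open>auto simp: field_simps\<close>)
qed

lemma lower_quant_dim_ge:
  assumes "0 < b" "\<forall>\<^sub>F N in sequentially. quant_rate N \<le> ereal (b * log 2 (real N))"
  shows "ereal (1 / b) \<le> lower_quant_dim \<nu>"
  unfolding lower_quant_dim_eq
proof (rule Liminf_bounded)
  show "\<forall>\<^sub>F N in sequentially. ereal (1 / b) \<le> ereal (log 2 (real N)) / quant_rate N"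
    using assms(2) eventually_quant_rate_real
    by eventually_elim (use assms(1) in \<open>auto simp: field_simps\<close>)
qed

text \<open>The Laplace integral runs over all \<open>u >= 0\<close>, so an eventual bound is made
  global; by monotonicity F at the starting point serves as constant.\<close>

lemma F_fun_linear_upper_bound:
  assumes "0 \<le> b" "\<forall>\<^sub>F u in at_top. F_fun \<nu> u \<le> b * u"
  shows "\<exists>B\<ge>0. \<forall>u\<ge>0. F_fun \<nu> u \<le> b * u + B"
proof -
  obtain U where U: "\<And>u. U \<le> u \<Longrightarrow> F_fun \<nu> u \<le> b * u"
    using assms(2) by (auto simp: eventually_at_top_linorder)
  have "F_fun \<nu> u \<le> b * u + F_fun \<nu> U" if "0 \<le> u" for u
    using U[of u] F_fun_mono[of u U] F_fun_nonneg[of U] mult_nonneg_nonneg[OF assms(1) that]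
    by (cases "U \<le> u") linarith+
  then show ?thesis using F_fun_nonneg by blast
qed

lemma F_fun_linear_lower_bound:
  assumes "0 \<le> b" "\<forall>\<^sub>F u in at_top. b * u \<le> F_fun \<nu> u"
  shows "\<exists>B\<ge>0. \<forall>u\<ge>0. b * u \<le> F_fun \<nu> u + B"
proof -
  obtain U where U: "\<And>u. U \<le> u \<Longrightarrow> b * u \<le> F_fun \<nu> u"
    using assms(2) by (auto simp: eventually_at_top_linorder)
  have "b * u \<le> F_fun \<nu> u + b * \<bar>U\<bar>" if "0 \<le> u" for u
  proof (cases "U \<le> u")
    case True
    then show ?thesis using U[of u] assms(1) mult_nonneg_nonneg[of b "\<bar>U\<bar>"] by linarith
  next
    case False
    then have "b * u \<le> b * \<bar>U\<bar>" using assms(1) by (intro mult_left_mono) auto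
    then show ?thesis using F_fun_nonneg[of u] by linarith
  qed
  moreover have "0 \<le> b * \<bar>U\<bar>" using assms(1) by simp
  ultimately show ?thesis by blast
qed

section \<open>The Abelian inequalities\<close>

definition scaled_Z :: "real \<Rightarrow> real" where
  "scaled_Z q = (q - 1) * ln 2 * Z_sum \<nu> q"

lemma Liminf_scaled_Z_ge:
  assumes "0 \<le> b" "\<forall>\<^sub>F u in at_top. b * u \<le> F_fun \<nu> u"
  shows "ereal b \<le> Liminf (at_right 1) (\<lambda>q. ereal (scaled_Z q))"
proof -
  obtain B where B: "0 \<le> B" "\<And>u. 0 \<le> u \<Longrightarrow> b * u \<le> F_fun \<nu> u + B"
    using F_fun_linear_lower_bound[OF assms] by blast
  have "((\<lambda>q. ereal (b - B * ((q - 1) * ln 2))) \<longlongrightarrow> ereal (b - B * ((1 - 1) * ln 2))) (at_right 1)"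
    by (intro tendsto_intros)
  then have "Liminf (at_right 1) (\<lambda>q. ereal (b - B * ((q - 1) * ln 2))) = ereal b"
    by (intro lim_imp_Liminf trivial_limit_at_right_real) simp
  moreover have "Liminf (at_right 1) (\<lambda>q. ereal (b - B * ((q - 1) * ln 2))) \<le> Liminf (at_right 1) (\<lambda>q. ereal (scaled_Z q))"
  proof (rule Liminf_mono)
    show "\<forall>\<^sub>F q in at_right 1. ereal (b - B * ((q - 1) * ln 2)) \<le> ereal (scaled_Z q)"
      using eventually_at_right_less[of "1::real"]
    proof eventually_elim
      case (elim q)
      then show ?case using Z_sum_ge[OF _ assms(1) B, of "(q - 1) * ln 2"] by (simp add: scaled_Z_def)
    qed
  qed
  ultimately show ?thesis by simp
qed

lemma Limsup_scaled_Z_le: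
  assumes "0 \<le> b" "\<forall>\<^sub>F u in at_top. F_fun \<nu> u \<le> b * u"
  shows "Limsup (at_right 1) (\<lambda>q. ereal (scaled_Z q)) \<le> ereal b"
proof -
  obtain B where B: "0 \<le> B" "\<And>u. 0 \<le> u \<Longrightarrow> F_fun \<nu> u \<le> b * u + B"
    using F_fun_linear_upper_bound[OF assms] by blast
  have "((\<lambda>q. ereal (b + B * ((q - 1) * ln 2))) \<longlongrightarrow> ereal (b + B * ((1 - 1) * ln 2))) (at_right 1)"
    by (intro tendsto_intros)
  then have "Limsup (at_right 1) (\<lambda>q. ereal (b + B * ((q - 1) * ln 2))) = ereal b"
    by (intro lim_imp_Limsup trivial_limit_at_right_real) simp
  moreover have "Limsup (at_right 1) (\<lambda>q. ereal (scaled_Z q)) \<le> Limsup (at_right 1) (\<lambda>q. ereal (b + B * ((q - 1) * ln 2)))"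
  proof (rule Limsup_mono)
    show "\<forall>\<^sub>F q in at_right 1. ereal (scaled_Z q) \<le> ereal (b + B * ((q - 1) * ln 2))"
      using eventually_at_right_less[of "1::real"]
    proof eventually_elim
      case (elim q)
      then show ?case using Z_sum_le[OF _ assms(1) B, of "(q - 1) * ln 2"] by (simp add: scaled_Z_def)
    qed
  qed
  ultimately show ?thesis by simp
qed

lemma inverse_upper_quant_dim_le:
  "1 / upper_quant_dim \<nu> \<le> Liminf (at_right 1) (\<lambda>q. ereal (scaled_Z q))"
proof (rule dense_le)
  fix x :: ereal assume x: "x < 1 / upper_quant_dim \<nu>"
  show "x \<le> Liminf (at_right 1) (\<lambda>q. ereal (scaled_Z q))"
  proof (cases "x < 0")
    case True
    have "0 \<le> Liminf (at_right 1) (\<lambda>q. ereal (scaled_Z q))"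
      unfolding zero_ereal_def by (rule Liminf_scaled_Z_ge) (simp_all add: F_fun_nonneg)
    with True show ?thesis by (rule order_trans[OF less_imp_le])
  next
    case False
    \<comment> \<open>Two intermediate slopes are needed: the passage from the rate to F lowers
      \<open>b\<close> to \<open>b'\<close>.\<close>
    obtain b' where b': "x < ereal b'" "ereal b' < 1 / upper_quant_dim \<nu>" using ereal_dense2[OF x] by blast
    obtain b where b: "ereal b' < ereal b" "ereal b < 1 / upper_quant_dim \<nu>" using ereal_dense2[OF b'(2)] by blast
    have "0 < ereal b'" using le_less_trans[OF _ b'(1), of 0] False by (simp add: not_less)
    then have pos: "0 < b'" by simp
    have "\<forall>\<^sub>F u in at_top. b' * u \<le> F_fun \<nu> u"
    proof (rule F_fun_ge_if_quant_rate_ge[OF pos])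
      show "b' < b" using b(1) by simp
      then show "\<forall>\<^sub>F N in sequentially. ereal (b * log 2 (real N)) \<le> quant_rate N"
        using pos b(2) by (intro quant_rate_ge_if_upper) simp_all
    qed
    then have "ereal b' \<le> Liminf (at_right 1) (\<lambda>q. ereal (scaled_Z q))"
      by (rule Liminf_scaled_Z_ge[OF less_imp_le[OF pos]])
    with b'(1) show ?thesis by (rule order_trans[OF less_imp_le])
  qed
qed

lemma inverse_lower_quant_dim_ge:
  "Limsup (at_right 1) (\<lambda>q. ereal (scaled_Z q)) \<le> 1 / lower_quant_dim \<nu>"
proof (rule dense_ge)
  fix x :: ereal assume x: "1 / lower_quant_dim \<nu> < x"
  obtain b where b: "1 / lower_quant_dim \<nu> < ereal b" "ereal b < x" using ereal_dense2[OF x] by blast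
  obtain b' where b': "ereal b < ereal b'" "ereal b' < x" using ereal_dense2[OF b(2)] by blast
  have "0 \<le> 1 / lower_quant_dim \<nu>"
    using lower_quant_dim_nonneg by simp
  then have "0 < ereal b" using b(1) by (rule le_less_trans)
  then have pos: "0 < b" by simp
  have "\<forall>\<^sub>F u in at_top. F_fun \<nu> u \<le> b' * u"
  proof (rule F_fun_le_if_quant_rate_le[OF pos])
    show "b < b'" using b'(1) by simp
    show "\<forall>\<^sub>F N in sequentially. quant_rate N \<le> ereal (b * log 2 (real N))"
      by (rule quant_rate_le_if_lower[OF pos b(1)])
  qed
  then have "Limsup (at_right 1) (\<lambda>q. ereal (scaled_Z q)) \<le> ereal b'"
    using pos b'(1) by (intro Limsup_scaled_Z_le) simp_all
  then show "Limsup (at_right 1) (\<lambda>q. ereal (scaled_Z q)) \<le> x" using b'(2)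
    by (rule order_trans[OF _ less_imp_le])
qed

text \<open>Slopes below \<open>c\<close> bound the upper dimension and slopes above
  \<open>c\<close> bound the lower one; a gap between the dimensions would contradict this.\<close>

lemma quant_dim_exists_if_F_fun:
  assumes "((\<lambda>u. F_fun \<nu> u / u) \<longlongrightarrow> c) at_top"
  shows "quant_dim_exists \<nu>"
proof -
  have upper: "upper_quant_dim \<nu> \<le> ereal (1 / b)" if b0: "0 < b" and bc: "b < c" for b
  proof -
    obtain m where m: "b < m" "m < c" using dense[OF bc] by blast
    have "\<forall>\<^sub>F u in at_top. m < F_fun \<nu> u / u" using assms m(2) by (rule order_tendstoD)
    then have "\<forall>\<^sub>F u in at_top. m * u \<le> F_fun \<nu> u"
      using eventually_gt_at_top[of 0] by eventually_elim (simp add: pos_less_divide_eq)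
    then have "\<forall>\<^sub>F N in sequentially. ereal (b * log 2 (real N)) \<le> quant_rate N"
      by (rule quant_rate_ge_if_F_fun_ge[OF b0 m(1)])
    then show ?thesis by (rule upper_quant_dim_le[OF b0])
  qed
  have lower: "ereal (1 / b) \<le> lower_quant_dim \<nu>" if bc: "0 < b" "c < b" for b
  proof -
    \<comment> \<open>The transfer requires a positive slope, and \<open>c\<close> is not known to
      be positive.\<close>
    have "max 0 c < b" using bc by simp
    from dense[OF this] obtain m where m: "max 0 c < m" "m < b" by blast
    have "\<forall>\<^sub>F u in at_top. F_fun \<nu> u / u < m" using assms m(1) by (intro order_tendstoD) auto
    then have "\<forall>\<^sub>F u in at_top. F_fun \<nu> u \<le> m * u"
      using eventually_gt_at_top[of 0] by eventually_elim (simp add: pos_divide_less_eq)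
    then have "\<forall>\<^sub>F N in sequentially. quant_rate N \<le> ereal (b * log 2 (real N))"
      using m by (intro quant_rate_le_if_F_fun_le[of m b]) auto
    then show ?thesis by (rule lower_quant_dim_ge[OF bc(1)])
  qed
  have "upper_quant_dim \<nu> \<le> lower_quant_dim \<nu>"
  proof (rule dense_ge)
    fix x assume x: "lower_quant_dim \<nu> < x"
    obtain y where y: "lower_quant_dim \<nu> < ereal y" "ereal y < x" using ereal_dense2[OF x] by blast
    have "0 < y" using le_less_trans[OF lower_quant_dim_nonneg y(1)] by simp
    obtain z where z: "lower_quant_dim \<nu> < ereal z" "ereal z < ereal y" using ereal_dense2[OF y(1)] by blast
    have "0 < z" using le_less_trans[OF lower_quant_dim_nonneg z(1)] by simp
    \<comment> \<open>Otherwise \<open>lower\<close> would give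
      \<open>z <= lower_quant_dim \<nu>\<close>. Hence 1/z <= c, and 1/y lies strictly below
      \<open>c\<close>, so that \<open>upper\<close> applies to it.\<close>
    have "\<not> c < 1 / z"
    proof
      assume "c < 1 / z"
      then have "ereal (1 / (1 / z)) \<le> lower_quant_dim \<nu>" using \<open>0 < z\<close> by (intro lower) simp_all
      then show False using z(1) by simp
    qed
    moreover have "1 / y < 1 / z" using z(2) \<open>0 < z\<close> by (simp add: frac_less2)
    ultimately have "upper_quant_dim \<nu> \<le> ereal (1 / (1 / y))" using \<open>0 < y\<close> by (intro upper) simp_all
    then have "upper_quant_dim \<nu> \<le> ereal y" by simp
    then show "upper_quant_dim \<nu> \<le> x" using y(2) by (rule order_trans[OF _ less_imp_le])
  qed
  then show ?thesis unfolding quant_dim_exists_def using lower_le_upper_quant_dim by (rule antisym[rotated])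
qed

end

section \<open>A Tauberian theorem of Karamata type\<close>

lemma continuous_unit_bounded:
  fixes f :: "real \<Rightarrow> real"
  assumes "continuous_on {0..1} f"
  shows "\<exists>M. \<forall>y\<in>{0..1}. \<bar>f y\<bar> \<le> M"
  using compact_imp_bounded[OF compact_continuous_image[OF assms compact_Icc]]
  by (auto simp: bounded_iff)

lemma has_integral_inverse_Icc:
  fixes r :: real
  assumes "0 < r" "r \<le> 1"
  shows "((\<lambda>y. 1 / y) has_integral - ln r) {r..1}"
proof -
  have "((\<lambda>y. 1 / y) has_integral ln 1 - ln r) {r..1}"
  proof (rule fundamental_theorem_of_calculus)
    fix y assume "y \<in> {r..1}"
    then have "(ln has_real_derivative 1 / y) (at y)" using assms by (auto intro!: derivative_eq_intros)
    then show "(ln has_vector_derivative 1 / y) (at y within {r..1})"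
      by (simp add: has_real_derivative_iff_has_vector_derivative has_vector_derivative_at_within)
  qed (use assms in simp)
  then show ?thesis by simp
qed

lemma has_integral_polynomial_unit:
  fixes c :: "nat \<Rightarrow> real"
  shows "((\<lambda>y. \<Sum>i\<le>n. c i * y ^ i) has_integral (\<Sum>i\<le>n. c i * (1 / real (Suc i)))) {0..1}"
proof (rule has_integral_sum)
  fix i
  have "((\<lambda>y::real. y ^ i) has_integral (1 ^ Suc i / real (Suc i) - 0 ^ Suc i / real (Suc i))) {0..1}"
  proof (rule fundamental_theorem_of_calculus)
    fix y :: real
    have "((\<lambda>y. y ^ Suc i / real (Suc i)) has_real_derivative y ^ i) (at y)"
      by (auto intro!: derivative_eq_intros simp del: power_Suc)
    then show "((\<lambda>y. y ^ Suc i / real (Suc i)) has_vector_derivative y ^ i) (at y within {0..1})"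
      by (simp add: has_real_derivative_iff_has_vector_derivative has_vector_derivative_at_within del: power_Suc)
  qed simp
  then show "((\<lambda>y. c i * y ^ i) has_integral c i * (1 / real (Suc i))) {0..1}"
    by (intro has_integral_mult_right) simp
qed simp

text \<open>A continuous function between \<open>1 / y\<close> cut off to \<open>[r, 1]\<close> and \<open>1 / y\<close> cut off to \<open>[p, 1]\<close>.\<close>

definition ramp :: "real \<Rightarrow> real \<Rightarrow> real \<Rightarrow> real" where
  "ramp p r y = min 1 (max 0 ((y - p) / (r - p))) / max y p"

lemma ramp_bounds:
  assumes "0 < p" "p < r"
  shows "0 \<le> ramp p r y" "r \<le> y \<Longrightarrow> ramp p r y = 1 / y" "y \<le> p \<Longrightarrow> ramp p r y = 0" "p \<le> y \<Longrightarrow> ramp p r y \<le> 1 / y"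
proof -
  have pos: "0 < max y p" using assms by simp
  then show "0 \<le> ramp p r y" by (simp add: ramp_def)
  show "r \<le> y \<Longrightarrow> ramp p r y = 1 / y" using assms by (simp add: ramp_def max_absorb1)
  show "y \<le> p \<Longrightarrow> ramp p r y = 0" using assms by (simp add: ramp_def divide_nonpos_pos max_absorb1)
  show "p \<le> y \<Longrightarrow> ramp p r y \<le> 1 / y" using assms by (simp add: ramp_def divide_right_mono max_absorb1)
qed

lemma ramp_bounded:
  assumes "0 < p" "p < r" "y \<in> {0..1}"
  shows "\<bar>ramp p r y\<bar> \<le> 1 / p"
proof -
  have "ramp p r y \<le> 1 / p"
  proof (cases "p \<le> y")
    case True
    then have "ramp p r y \<le> 1 / y" using ramp_bounds(4)[OF assms(1,2)] by blast
    also have "\<dots> \<le> 1 / p" using True assms by (simp add: frac_le)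
    finally show ?thesis .
  qed (use ramp_bounds(3)[OF assms(1,2), of y] assms in auto)
  then show ?thesis using ramp_bounds(1)[OF assms(1,2), of y] by simp
qed

text \<open>The denominator \<open>max y p\<close> avoids the singularity at 0; it departs from
  \<open>y\<close> only below \<open>p\<close>, where the numerator vanishes.\<close>

lemma continuous_ramp:
  assumes "0 < p" "p < r"
  shows "continuous_on S (ramp p r)"
  unfolding ramp_def using assms by (intro continuous_intros) auto

text \<open>The ramp lies between the sharp cut-offs of 1/y at \<open>r\<close> and at
  \<open>p\<close>, whose integrals are - ln r and - ln p.\<close>

lemma integral_ramp:
  assumes "0 < p" "p < r" "r < 1"
  shows "- ln r \<le> integral {0..1} (ramp p r)" "integral {0..1} (ramp p r) \<le> - ln p"
proof -
  have ramp: "(ramp p r has_integral integral {0..1} (ramp p r)) {0..1}"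
    by (intro integrable_integral integrable_continuous_real continuous_ramp assms)
  have cut: "((\<lambda>y. if y \<in> {x..1} then 1 / y else 0) has_integral - ln x) {0..1}" if "0 < x" "x \<le> 1" for x :: real
    using has_integral_inverse_Icc[OF that] that by (subst has_integral_restrict) auto
  show "- ln r \<le> integral {0..1} (ramp p r)"
    by (rule has_integral_le[OF cut ramp]) (use assms ramp_bounds[OF assms(1,2)] in auto)
  show "integral {0..1} (ramp p r) \<le> - ln p"
    by (rule has_integral_le[OF ramp cut]) (use assms ramp_bounds[OF assms(1,2)] in auto)
qed

context dyadic_mass
begin

text \<open>Karamata's functional: for \<open>s > 0\<close>, s times the integral of y f(y) against
  dF with y = 2^(-su). Powers f give rescaled values of the Dirichlet series, and 1/y cut off at 1/2
  gives s F(1/s).\<close>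

definition moment :: "real \<Rightarrow> (real \<Rightarrow> real) \<Rightarrow> real" where
  "moment s f = s * (\<Sum>\<^sub>\<infinity>Q\<in>mass_cubes \<nu>. measure \<nu> Q powr (1 + s) * f (measure \<nu> Q powr s))"

lemma mass_powr_unit: "0 < s \<Longrightarrow> measure \<nu> Q powr s \<in> {0..1}"
  using powr_mono2[of s "measure \<nu> Q" 1] prob_le_1[of Q] by simp

lemma moment_summable:
  assumes "0 < s" "\<And>y. y \<in> {0..1} \<Longrightarrow> \<bar>f y\<bar> \<le> M"
  shows "(\<lambda>Q. measure \<nu> Q powr (1 + s) * f (measure \<nu> Q powr s)) summable_on mass_cubes \<nu>"
proof -
  have "(\<lambda>Q. measure \<nu> Q powr (1 + s) * M) summable_on mass_cubes \<nu>"
    using assms(1) by (intro summable_on_cmult_left summable_powr) simp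
  then have "(\<lambda>Q. norm (measure \<nu> Q powr (1 + s) * f (measure \<nu> Q powr s))) summable_on mass_cubes \<nu>"
    by (rule Infinite_Sum.abs_summable_on_comparison_test')
       (use assms mass_powr_unit in \<open>auto simp: abs_mult intro!: mult_left_mono\<close>)
  then show ?thesis by (rule abs_summable_summable)
qed

lemma moment_add:
  assumes "0 < s" "\<And>y. y \<in> {0..1} \<Longrightarrow> \<bar>f y\<bar> \<le> M" "\<And>y. y \<in> {0..1} \<Longrightarrow> \<bar>g y\<bar> \<le> M'"
  shows "moment s (\<lambda>y. f y + g y) = moment s f + moment s g"
  unfolding moment_def distrib_left
  by (subst infsum_add[OF moment_summable moment_summable]) (use assms in \<open>auto simp: distrib_left\<close>)

lemma moment_cmult: "moment s (\<lambda>y. c * f y) = c * moment s f"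
  unfolding moment_def by (subst mult.left_commute, subst infsum_cmult_right') simp

lemma moment_mono:
  assumes "0 < s" "\<And>y. y \<in> {0..1} \<Longrightarrow> \<bar>f y\<bar> \<le> M" "\<And>y. y \<in> {0..1} \<Longrightarrow> \<bar>g y\<bar> \<le> M'"
    and "\<And>y. y \<in> {0..1} \<Longrightarrow> f y \<le> g y"
  shows "moment s f \<le> moment s g"
  unfolding moment_def using assms(1) mass_powr_unit[OF assms(1)]
  by (intro mult_left_mono infsum_mono moment_summable[OF assms(1,2)] moment_summable[OF assms(1,3)] assms(4)) auto

text \<open>The exponents add up to 1 + (n+1) s. The redundant factors display s' Z(1 + s') with s'
  = (n+1) s, ready for the assumed limit.\<close>

lemma moment_power: "0 < s \<Longrightarrow> moment s (\<lambda>y. y ^ n) = 1 / real (Suc n) * (real (Suc n) * s * Z_sum \<nu> (1 + real (Suc n) * s))"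
proof -
  have "measure \<nu> Q powr (1 + s) * (measure \<nu> Q powr s) ^ n = measure \<nu> Q powr (1 + real (Suc n) * s)"
    if "Q \<in> mass_cubes \<nu>" for Q
    using that by (simp add: mass_cubes_def powr_realpow[symmetric] powr_powr algebra_simps flip: powr_add)
  then have "moment s (\<lambda>y. y ^ n) = s * Z_sum \<nu> (1 + real (Suc n) * s)"
    unfolding moment_def Z_sum_def by (simp cong: infsum_cong)
  then show ?thesis by simp
qed

text \<open>Raising the mass to the power \<open>s\<close> turns the moving threshold
  \<open>2 powr (- 1 / s)\<close> into the fixed cut-off 1/2.\<close>

lemma mass_powr_ge_half_iff:
  assumes "Q \<in> mass_cubes \<nu>" "0 < s"
  shows "1 / 2 \<le> measure \<nu> Q powr s \<longleftrightarrow> Q \<in> F_cubes \<nu> (1 / s)"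
proof -
  have half: "(1 / 2 :: real) = 2 powr (- 1)" by (simp add: powr_minus_divide)
  have "1 / 2 \<le> 2 powr (- s * log_mass Q) \<longleftrightarrow> - 1 \<le> - s * log_mass Q"
    unfolding half by (rule powr_le_cancel_iff) simp
  also have "\<dots> \<longleftrightarrow> log_mass Q \<le> 1 / s" using assms(2) by (simp add: field_simps)
  finally show ?thesis using assms(1) unfolding powr_log_mass[OF assms(1)] by (simp only: F_cubes_eq) simp
qed

text \<open>This ramp equals 1/y from 1/2 on, which reproduces the masses counted by F(1/s), and is
  nonnegative elsewhere.\<close>

lemma F_fun_le_moment_ramp:
  assumes s: "0 < s" and p: "0 < p" "p < 1 / 2"
  shows "s * F_fun \<nu> (1 / s) \<le> moment s (ramp p (1 / 2))"
  unfolding moment_def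
proof (rule mult_left_mono)
  let ?g = "\<lambda>Q. measure \<nu> Q powr (1 + s) * ramp p (1 / 2) (measure \<nu> Q powr s)"
  have sub: "F_cubes \<nu> (1 / s) \<subseteq> mass_cubes \<nu>" by (auto simp: F_cubes_eq)
  have "F_fun \<nu> (1 / s) = sum ?g (F_cubes \<nu> (1 / s))"
    unfolding F_fun_eq_sum
  proof (rule sum.cong[OF refl])
    fix Q assume Q: "Q \<in> F_cubes \<nu> (1 / s)"
    then have mQ: "Q \<in> mass_cubes \<nu>" using sub by blast
    then have "1 / 2 \<le> measure \<nu> Q powr s" using Q mass_powr_ge_half_iff s by blast
    then have "ramp p (1 / 2) (measure \<nu> Q powr s) = 1 / (measure \<nu> Q powr s)" using ramp_bounds(2)[OF p] by blast
    then show "measure \<nu> Q = ?g Q" using mQ by (simp add: measure_powr_eq mass_cubes_def)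
  qed
  also have "\<dots> \<le> infsum ?g (mass_cubes \<nu>)"
    using ramp_bounds(1)[OF p]
    by (intro finite_sum_le_infsum moment_summable[OF s ramp_bounded[OF p]] finite_F_cubes sub) auto
  finally show "F_fun \<nu> (1 / s) \<le> infsum ?g (mass_cubes \<nu>)" .
qed (use s in simp)

text \<open>This ramp vanishes up to 1/2, so only cubes of F(1/s) contribute, each at most its
  mass.\<close>

lemma moment_ramp_le_F_fun:
  assumes s: "0 < s" and r: "1 / 2 < r"
  shows "moment s (ramp (1 / 2) r) \<le> s * F_fun \<nu> (1 / s)"
  unfolding moment_def
proof (rule mult_left_mono)
  let ?g = "\<lambda>Q. measure \<nu> Q powr (1 + s) * ramp (1 / 2) r (measure \<nu> Q powr s)"
  have half: "(0::real) < 1 / 2" by simp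
  have sub: "F_cubes \<nu> (1 / s) \<subseteq> mass_cubes \<nu>" by (auto simp: F_cubes_eq)
  have "infsum ?g (mass_cubes \<nu>) = infsum ?g (F_cubes \<nu> (1 / s))"
  proof (rule infsum_cong_neutral)
    fix Q assume Q: "Q \<in> mass_cubes \<nu> - F_cubes \<nu> (1 / s)"
    then have "\<not> 1 / 2 \<le> measure \<nu> Q powr s" using mass_powr_ge_half_iff s by blast
    then have "ramp (1 / 2) r (measure \<nu> Q powr s) = 0" using ramp_bounds(3)[OF half r] by simp
    then show "?g Q = 0" by simp
  qed (use sub in auto)
  also have "\<dots> = sum ?g (F_cubes \<nu> (1 / s))" by (simp add: finite_F_cubes)
  also have "\<dots> \<le> F_fun \<nu> (1 / s)"
    unfolding F_fun_eq_sum
  proof (rule sum_mono)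
    fix Q assume Q: "Q \<in> F_cubes \<nu> (1 / s)"
    then have mQ: "Q \<in> mass_cubes \<nu>" using sub by blast
    then have "1 / 2 \<le> measure \<nu> Q powr s" using Q mass_powr_ge_half_iff s by blast
    then have "ramp (1 / 2) r (measure \<nu> Q powr s) \<le> 1 / (measure \<nu> Q powr s)" using ramp_bounds(4)[OF half r] by blast
    then have "?g Q \<le> measure \<nu> Q powr (1 + s) * (1 / (measure \<nu> Q powr s))" by (rule mult_left_mono) simp
    then show "?g Q \<le> measure \<nu> Q" using mQ by (simp add: measure_powr_eq mass_cubes_def)
  qed
  finally show "infsum ?g (mass_cubes \<nu>) \<le> F_fun \<nu> (1 / s)" .
qed (use s in simp)

context
  fixes c :: real
  assumes Z_limit: "((\<lambda>s. s * Z_sum \<nu> (1 + s)) \<longlongrightarrow> c) (at_right 0)"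
begin

lemma tendsto_moment_power: "((\<lambda>s. moment s (\<lambda>y. y ^ n)) \<longlongrightarrow> c * (1 / real (Suc n))) (at_right 0)"
proof -
  have "filterlim (\<lambda>s. real (Suc n) * s) (at_right 0) (at_right 0)"
    unfolding filterlim_at by (auto intro!: tendsto_eq_intros eventually_at_right_less simp: eventually_at_filter)
  from tendsto_mult_left[OF filterlim_compose[OF Z_limit this], of "1 / real (Suc n)"]
  have "((\<lambda>s. 1 / real (Suc n) * (real (Suc n) * s * Z_sum \<nu> (1 + real (Suc n) * s))) \<longlongrightarrow> c * (1 / real (Suc n))) (at_right 0)"
    by (simp add: mult.commute)
  then show ?thesis
  proof (rule Lim_transform_eventually)
    show "\<forall>\<^sub>F s in at_right 0. 1 / real (Suc n) * (real (Suc n) * s * Z_sum \<nu> (1 + real (Suc n) * s)) = moment s (\<lambda>y. y ^ n)"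
      using eventually_at_right_less[of 0] by eventually_elim (simp only: moment_power)
  qed
qed

text \<open>Induction on the degree, since additivity of \<open>moment\<close> is available for
  bounded functions, where the sums converge. The limit is c times the integral over [0, 1].\<close>

lemma tendsto_moment_polynomial:
  "((\<lambda>s. moment s (\<lambda>y. \<Sum>i\<le>n. b i * y ^ i)) \<longlongrightarrow> c * (\<Sum>i\<le>n. b i * (1 / real (Suc i)))) (at_right 0)"
proof (induction n)
  case 0
  have "((\<lambda>s. b 0 * moment s (\<lambda>y. y ^ 0)) \<longlongrightarrow> b 0 * (c * (1 / real (Suc 0)))) (at_right 0)"
    by (intro tendsto_mult_left tendsto_moment_power)
  then show ?case by (simp add: moment_cmult[symmetric] mult.commute)
next
  case (Suc n)
  have "continuous_on {0..1} (\<lambda>y. \<Sum>i\<le>n. b i * y ^ i)" "continuous_on {0..1} (\<lambda>y. b (Suc n) * y ^ Suc n)"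
    by (intro continuous_intros)+
  from this[THEN continuous_unit_bounded]
  obtain M M' where M: "\<And>y. y \<in> {0..1} \<Longrightarrow> \<bar>\<Sum>i\<le>n. b i * y ^ i\<bar> \<le> M"
    and M': "\<And>y. y \<in> {0..1} \<Longrightarrow> \<bar>b (Suc n) * y ^ Suc n\<bar> \<le> M'"
    by blast
  have "((\<lambda>s. moment s (\<lambda>y. \<Sum>i\<le>n. b i * y ^ i) + b (Suc n) * moment s (\<lambda>y. y ^ Suc n)) \<longlongrightarrow>
     c * (\<Sum>i\<le>n. b i * (1 / real (Suc i))) + b (Suc n) * (c * (1 / real (Suc (Suc n))))) (at_right 0)"
    by (intro tendsto_add tendsto_mult_left tendsto_moment_power Suc.IH)
  also have "c * (\<Sum>i\<le>n. b i * (1 / real (Suc i))) + b (Suc n) * (c * (1 / real (Suc (Suc n)))) =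
     c * (\<Sum>i\<le>Suc n. b i * (1 / real (Suc i)))"
    by (simp only: sum.atMost_Suc distrib_left mult.left_commute)
  finally show ?case
  proof (rule Lim_transform_eventually)
    show "\<forall>\<^sub>F s in at_right 0. moment s (\<lambda>y. \<Sum>i\<le>n. b i * y ^ i) + b (Suc n) * moment s (\<lambda>y. y ^ Suc n) =
      moment s (\<lambda>y. \<Sum>i\<le>Suc n. b i * y ^ i)"
      using eventually_at_right_less[of 0]
    proof eventually_elim
      case (elim s)
      show ?case using moment_add[OF elim M M'] by (simp only: sum.atMost_Suc moment_cmult)
    qed
  qed
qed

lemma limit_nonneg: "0 \<le> c"
proof (rule tendsto_lowerbound[OF Z_limit])
  show "\<forall>\<^sub>F s in at_right 0. 0 \<le> s * Z_sum \<nu> (1 + s)"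
    using eventually_at_right_less[of 0] by eventually_elim (simp add: Z_sum_nonneg)
qed simp

text \<open>Weierstrass approximation passes to the limit because \<open>moment s\<close> is
  monotone and its value at the constant 1 converges to \<open>c\<close>.\<close>

lemma tendsto_moment_continuous:
  assumes f: "continuous_on {0..1} f"
  shows "((\<lambda>s. moment s f) \<longlongrightarrow> c * integral {0..1} f) (at_right 0)"
proof (rule tendstoI)
  fix e :: real assume e: "0 < e"
  \<comment> \<open>The total error is below d (2c + 1), hence below 2 (c + 1) d = e; adding 1 also
    covers \<open>c = 0\<close>.\<close>
  define d where "d = e / (2 * (c + 1))"
  have d: "0 < d" using e limit_nonneg by (simp add: d_def)
  obtain p where p: "real_polynomial_function p" "\<And>y. y \<in> {0..1} \<Longrightarrow> \<bar>f y - p y\<bar> < d"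
    using Stone_Weierstrass_real_polynomial_function[OF compact_Icc f d] by blast
  obtain b n where p_eq: "p = (\<lambda>y. \<Sum>i\<le>n. b i * y ^ i)"
    using p(1) unfolding real_polynomial_function_iff_sum by blast
  have p_cont: "continuous_on {0..1} p" unfolding p_eq by (intro continuous_intros)
  have int_p: "integral {0..1} p = (\<Sum>i\<le>n. b i * (1 / real (Suc i)))"
    unfolding p_eq by (rule integral_unique[OF has_integral_polynomial_unit])
  have "\<bar>integral {0..1} (\<lambda>y. f y - p y)\<bar> \<le> d * (1 - 0)"
    using p(2) by (intro integral_bound[where 'a = real, simplified] continuous_on_diff f p_cont) (auto intro: less_imp_le)
  moreover have "integral {0..1} (\<lambda>y. f y - p y) = integral {0..1} f - integral {0..1} p"
    by (intro integral_diff integrable_continuous_real f p_cont)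
  ultimately have "c * \<bar>integral {0..1} f - integral {0..1} p\<bar> \<le> c * d"
    using limit_nonneg by (intro mult_left_mono) auto
  then have int_bound: "\<bar>c * integral {0..1} f - c * integral {0..1} p\<bar> \<le> c * d"
    using limit_nonneg by (simp add: abs_mult flip: right_diff_distrib)
  obtain M where M: "\<And>y. y \<in> {0..1} \<Longrightarrow> \<bar>f y\<bar> \<le> M" using continuous_unit_bounded[OF f] by blast
  obtain M' where M': "\<And>y. y \<in> {0..1} \<Longrightarrow> \<bar>p y\<bar> \<le> M'" using continuous_unit_bounded[OF p_cont] by blast
  have "((\<lambda>s. \<bar>moment s p - c * integral {0..1} p\<bar> + d * moment s (\<lambda>y. 1)) \<longlongrightarrow>
      \<bar>c * integral {0..1} p - c * integral {0..1} p\<bar> + d * c) (at_right 0)"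
    using tendsto_moment_polynomial[of b n] tendsto_moment_power[of 0] unfolding p_eq[symmetric] int_p[symmetric]
    by (intro tendsto_add tendsto_rabs tendsto_diff tendsto_mult_left tendsto_const) simp_all
  moreover have "\<bar>c * integral {0..1} p - c * integral {0..1} p\<bar> + d * c < d * c + d" using d by simp
  ultimately have "\<forall>\<^sub>F s in at_right 0. \<bar>moment s p - c * integral {0..1} p\<bar> + d * moment s (\<lambda>y. 1) < d * c + d"
    by (rule order_tendstoD)
  then show "\<forall>\<^sub>F s in at_right 0. dist (moment s f) (c * integral {0..1} f) < e"
    using eventually_at_right_less[of 0]
  proof eventually_elim
    case (elim s)
    have "moment s f \<le> moment s (\<lambda>y. p y + d * 1)"
    proof (rule moment_mono[OF elim(2) M])
      show "\<bar>p y + d * 1\<bar> \<le> M' + d" if "y \<in> {0..1}" for y using M'[OF that] d by simp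
      show "f y \<le> p y + d * 1" if "y \<in> {0..1}" for y using p(2)[OF that] by simp
    qed
    also have "\<dots> = moment s p + d * moment s (\<lambda>y. 1)"
      using moment_add[OF elim(2) M', where g = "\<lambda>y. d * 1" and M' = d] d by (simp only: moment_cmult)
    finally have "moment s f \<le> moment s p + d * moment s (\<lambda>y. 1)" .
    moreover have "moment s (\<lambda>y. p y + (- d) * 1) \<le> moment s f"
    proof (rule moment_mono[OF elim(2) _ M])
      show "\<bar>p y + (- d) * 1\<bar> \<le> M' + d" if "y \<in> {0..1}" for y using M'[OF that] d by simp
      show "p y + (- d) * 1 \<le> f y" if "y \<in> {0..1}" for y using p(2)[OF that] by simp
    qed
    moreover have "moment s (\<lambda>y. p y + (- d) * 1) = moment s p - d * moment s (\<lambda>y. 1)"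
      using moment_add[OF elim(2) M', where g = "\<lambda>y. (- d) * 1" and M' = d] d by (simp only: moment_cmult)
    ultimately have "\<bar>moment s f - moment s p\<bar> \<le> d * moment s (\<lambda>y. 1)" by linarith
    then have "\<bar>moment s f - c * integral {0..1} f\<bar> < d * c + d + c * d"
      using elim(1) int_bound by linarith
    also have "\<dots> \<le> 2 * (c + 1) * d" using d by (simp add: algebra_simps)
    also have "\<dots> = e" using limit_nonneg by (simp add: d_def)
    finally show ?case by (simp add: dist_real_def)
  qed
qed

text \<open>Squeeze between ramps with one edge fixed at 1/2 and the other approaching it; - ln is
  continuous there with value ln 2.\<close>

lemma tendsto_scaled_F_fun: "((\<lambda>s. s * F_fun \<nu> (1 / s)) \<longlongrightarrow> c * ln 2) (at_right 0)"
proof (rule order_tendstoI)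
  have lim: "((\<lambda>x. c * - ln x) \<longlongrightarrow> c * ln 2) (at (1 / 2))"
    by (auto intro!: tendsto_eq_intros simp: ln_div)
  fix m assume m: "m < c * ln 2"
  have "\<forall>\<^sub>F x in at_right (1 / 2). m < c * - ln x"
    by (rule order_tendstoD(1)[OF tendsto_mono[OF at_le[OF subset_UNIV] lim] m])
  moreover have "\<forall>\<^sub>F x in at_right (1 / 2). x < (1::real)"
    unfolding eventually_at_right_field by (rule exI[of _ 1]) simp
  ultimately have "\<forall>\<^sub>F x in at_right (1 / 2). m < c * - ln x \<and> x < 1 \<and> 1 / 2 < x"
    using eventually_at_right_less[of "1 / 2 :: real"] by eventually_elim simp
  then obtain r where r: "m < c * - ln r" "r < 1" "1 / 2 < r"
    using eventually_happens'[OF trivial_limit_at_right_real] by blast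
  have "m < c * integral {0..1} (ramp (1 / 2) r)"
    using r(1) mult_left_mono[OF integral_ramp(1)[of "1 / 2" r] limit_nonneg] r by auto
  moreover have "((\<lambda>s. moment s (ramp (1 / 2) r)) \<longlongrightarrow> c * integral {0..1} (ramp (1 / 2) r)) (at_right 0)"
    using r(3) by (intro tendsto_moment_continuous continuous_ramp) simp_all
  ultimately have "\<forall>\<^sub>F s in at_right 0. m < moment s (ramp (1 / 2) r)" by (rule order_tendstoD(1)[rotated])
  then show "\<forall>\<^sub>F s in at_right 0. m < s * F_fun \<nu> (1 / s)"
    using eventually_at_right_less[of 0]
    by eventually_elim (rule less_le_trans[OF _ moment_ramp_le_F_fun[OF _ r(3)]])
next
  have lim: "((\<lambda>x. c * - ln x) \<longlongrightarrow> c * ln 2) (at (1 / 2))"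
    by (auto intro!: tendsto_eq_intros simp: ln_div)
  fix m assume m: "c * ln 2 < m"
  have "\<forall>\<^sub>F x in at_left (1 / 2). c * - ln x < m"
    by (rule order_tendstoD(2)[OF tendsto_mono[OF at_le[OF subset_UNIV] lim] m])
  moreover have "\<forall>\<^sub>F x in at_left (1 / 2). 0 < x \<and> x < (1 / 2 :: real)"
    unfolding eventually_at_left_field by (rule exI[of _ 0]) simp
  ultimately have "\<forall>\<^sub>F x in at_left (1 / 2). c * - ln x < m \<and> 0 < x \<and> x < 1 / 2"
    by eventually_elim simp
  then obtain p where p: "c * - ln p < m" "0 < p" "p < 1 / 2"
    using eventually_happens'[OF trivial_limit_at_left_real] by blast
  have "c * integral {0..1} (ramp p (1 / 2)) < m"
    using p(1) mult_left_mono[OF integral_ramp(2)[of p "1 / 2"] limit_nonneg] p by auto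
  moreover have "((\<lambda>s. moment s (ramp p (1 / 2))) \<longlongrightarrow> c * integral {0..1} (ramp p (1 / 2))) (at_right 0)"
    using p(2,3) by (intro tendsto_moment_continuous continuous_ramp)
  ultimately have "\<forall>\<^sub>F s in at_right 0. moment s (ramp p (1 / 2)) < m" by (rule order_tendstoD(2)[rotated])
  then show "\<forall>\<^sub>F s in at_right 0. s * F_fun \<nu> (1 / s) < m"
    using eventually_at_right_less[of 0]
    by eventually_elim (rule le_less_trans[OF F_fun_le_moment_ramp[OF _ p(2,3)]])
qed

lemma tendsto_F_fun: "((\<lambda>u. F_fun \<nu> u / u) \<longlongrightarrow> c * ln 2) at_top"
  using filterlim_compose[OF tendsto_scaled_F_fun filterlim_inverse_at_right_top]
  by (simp add: divide_inverse mult.commute)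

end

text \<open>When the dimensions agree, the Abelian chain collapses to a limit 1/D; what remains is
  that this limit is a real number.\<close>

lemma tendsto_scaled_Z:
  assumes "quant_dim_exists \<nu>"
  obtains L where "(scaled_Z \<longlongrightarrow> L) (at_right 1)" "quant_dim \<nu> = inverse (ereal L)"
proof -
  let ?D = "lower_quant_dim \<nu>"
  have upper: "upper_quant_dim \<nu> = ?D" using assms by (simp add: quant_dim_exists_def)
  have qd: "quant_dim \<nu> = ?D" unfolding quant_dim_def upper by (rule the_equality) auto
  have le: "Liminf (at_right 1) (\<lambda>q. ereal (scaled_Z q)) \<le> Limsup (at_right 1) (\<lambda>q. ereal (scaled_Z q))"
    by (rule Liminf_le_Limsup[OF trivial_limit_at_right_real])
  have 1: "1 / ?D \<le> Liminf (at_right 1) (\<lambda>q. ereal (scaled_Z q))"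
    using inverse_upper_quant_dim_le upper by simp
  have 2: "Limsup (at_right 1) (\<lambda>q. ereal (scaled_Z q)) \<le> 1 / ?D"
    by (rule inverse_lower_quant_dim_ge)
  have lim: "((\<lambda>q. ereal (scaled_Z q)) \<longlongrightarrow> 1 / ?D) (at_right 1)"
    by (rule Liminf_eq_Limsup[OF trivial_limit_at_right_real])
       (rule antisym[OF order_trans[OF le 2] 1], rule antisym[OF 2 order_trans[OF 1 le]])
  have nonneg: "0 \<le> 1 / ?D" using lower_quant_dim_nonneg by simp
  \<comment> \<open>The decay exponent bounds the growth rate of F, which makes 1/D finite.\<close>
  have "\<forall>\<^sub>F u in at_top. F_fun \<nu> u \<le> (1 / a + 1) * u"
  proof -
    have "\<forall>\<^sub>F u in at_top. 1 + (u + log 2 C) / a \<le> (1 / a + 1) * u"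
      using eventually_ge_at_top[of "1 + log 2 C / a"]
      by eventually_elim (simp add: algebra_simps add_divide_distrib)
    then show ?thesis using eventually_ge_at_top[of 0]
    proof eventually_elim
      case (elim u)
      then show ?case using F_fun_le_max_level[of u] unfolding max_level_def by linarith
    qed
  qed
  then have "Limsup (at_right 1) (\<lambda>q. ereal (scaled_Z q)) \<le> ereal (1 / a + 1)"
    using a_pos by (intro Limsup_scaled_Z_le) auto
  then have "1 / ?D \<le> ereal (1 / a + 1)" using order_trans[OF order_trans[OF 1 le]] by blast
  then obtain L where L: "1 / ?D = ereal L" using nonneg by (cases "1 / ?D") auto
  \<comment> \<open>Valid in the extended reals for nonnegative arguments, where 0 and infinity are
    exchanged.\<close>
  have "?D = inverse (inverse ?D)"
    using lower_quant_dim_nonneg by (cases ?D) auto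
  also have "inverse ?D = ereal L" using L by (simp add: divide_ereal_def)
  finally have "quant_dim \<nu> = inverse (ereal L)" using qd by simp
  moreover have "(scaled_Z \<longlongrightarrow> L) (at_right 1)" using lim L by simp
  ultimately show thesis using that by blast
qed

text \<open>Convergence gives existence through the Tauberian limit of F(u)/u; the other direction
  only divides the limit of \<open>scaled_Z\<close> by ln 2.\<close>

lemma quant_dim_exists_iff:
  "quant_dim_exists \<nu> \<longleftrightarrow> (\<exists>l::real. ((\<lambda>q. (q - 1) * Z_sum \<nu> q) \<longlongrightarrow> l) (at_right 1))"
proof
  assume "\<exists>l::real. ((\<lambda>q. (q - 1) * Z_sum \<nu> q) \<longlongrightarrow> l) (at_right 1)"
  then obtain l where l: "((\<lambda>q. (q - 1) * Z_sum \<nu> q) \<longlongrightarrow> l) (at_right 1)" by blast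
  have "filterlim (\<lambda>s::real. 1 + s) (at_right 1) (at_right 0)"
    unfolding filterlim_at by (auto intro!: tendsto_eq_intros eventually_at_right_less simp: eventually_at_filter)
  from filterlim_compose[OF l this] have "((\<lambda>s. s * Z_sum \<nu> (1 + s)) \<longlongrightarrow> l) (at_right 0)" by simp
  then show "quant_dim_exists \<nu>" by (rule quant_dim_exists_if_F_fun[OF tendsto_F_fun])
next
  assume "quant_dim_exists \<nu>"
  then obtain L where "(scaled_Z \<longlongrightarrow> L) (at_right 1)" using tendsto_scaled_Z by blast
  then have "((\<lambda>q. scaled_Z q * (1 / ln 2)) \<longlongrightarrow> L * (1 / ln 2)) (at_right 1)" by (intro tendsto_intros)
  then show "\<exists>l::real. ((\<lambda>q. (q - 1) * Z_sum \<nu> q) \<longlongrightarrow> l) (at_right 1)"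
    by (auto simp: scaled_Z_def)
qed

end

theorem corollary2p8:
  fixes \<nu> :: "(real ^ 'n) measure" and a C :: real
  assumes "prob_space \<nu>" and "sets \<nu> = sets borel"
    and "msupport \<nu> \<subseteq> interior (cbox 0 1)"
    and "a > 0" and "C \<ge> 1"
    and "\<And>k Q. Q \<in> dyadic_cubes k \<Longrightarrow> measure \<nu> Q \<le> C * 2 powr (- a * real k)"
  shows
    "(\<forall>q>1. (\<lambda>Q. measure \<nu> Q powr q) summable_on mass_cubes \<nu> \<and>
        (\<lambda>k. \<Sum>Q\<in>dyadic_cubes k \<inter> mass_cubes \<nu>. measure \<nu> Q powr q) sums Z_sum \<nu> q) \<and>
     (\<forall>u. measure \<nu> summable_on F_cubes \<nu> u) \<and>
     (\<forall>u>0. (\<lambda>Q. measure \<nu> Q * log 2 (side_length Q)) summable_on P_cubes \<nu> (2 powr (- u)) \<and>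
        F_fun \<nu> u = L_fun \<nu> (2 powr (- u))) \<and>
     (\<forall>u<0. F_fun \<nu> u = 0) \<and>
     mono (F_fun \<nu>) \<and> (\<forall>u. continuous (at_right u) (F_fun \<nu>)) \<and>
     (\<forall>u v. u \<le> v \<longrightarrow>
        emeasure (interval_measure (F_fun \<nu>)) {u<..v} = ennreal (F_fun \<nu> v - F_fun \<nu> u)) \<and>
     emeasure (interval_measure (F_fun \<nu>)) {0} = ennreal (F_fun \<nu> 0) \<and>
     (\<forall>s>0. set_integrable (interval_measure (F_fun \<nu>)) {0..} (\<lambda>u. 2 powr (- s * u)) \<and>
        Z_sum \<nu> (1 + s) = (LINT u:{0..}|interval_measure (F_fun \<nu>). 2 powr (- s * u))) \<and>
     1 / upper_quant_dim \<nu> \<le> Liminf (at_right 1) (\<lambda>q. ereal ((q - 1) * ln 2 * Z_sum \<nu> q)) \<and>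
     Liminf (at_right 1) (\<lambda>q. ereal ((q - 1) * ln 2 * Z_sum \<nu> q))
       \<le> Limsup (at_right 1) (\<lambda>q. ereal ((q - 1) * ln 2 * Z_sum \<nu> q)) \<and>
     Limsup (at_right 1) (\<lambda>q. ereal ((q - 1) * ln 2 * Z_sum \<nu> q)) \<le> 1 / lower_quant_dim \<nu> \<and>
     (quant_dim_exists \<nu> \<longleftrightarrow> (\<exists>l::real. ((\<lambda>q. (q - 1) * Z_sum \<nu> q) \<longlongrightarrow> l) (at_right 1))) \<and>
     (quant_dim_exists \<nu> \<longrightarrow>
        quant_dim \<nu> = inverse (ereal (Lim (at_right 1) (\<lambda>q.
          (q - 1) * ln 2 * (\<Sum>\<^sub>\<infinity>Q\<in>mass_cubes \<nu>. measure \<nu> Q powr q)))))"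
proof -
  interpret prob_space \<nu> by (rule assms(1))
  interpret dyadic_mass \<nu> a C
  proof
    show "AE x in \<nu>. x \<in> cbox 0 1"
      using AE_msupport[OF assms(2)]
    proof eventually_elim
      case (elim x)
      then show ?case using assms(3) interior_subset by blast
    qed
  qed (use assms in auto)
  have finite_summable: "(\<lambda>Q. measure \<nu> Q * log 2 (side_length Q)) summable_on P_cubes \<nu> (2 powr (- u))" for u
    by (rule summable_on_finite[OF finite_P_cubes])
  have dim: "quant_dim \<nu> = inverse (ereal (Lim (at_right 1) (\<lambda>q.
      (q - 1) * ln 2 * (\<Sum>\<^sub>\<infinity>Q\<in>mass_cubes \<nu>. measure \<nu> Q powr q))))" if exists: "quant_dim_exists \<nu>"
  proof -
    obtain L where L: "(scaled_Z \<longlongrightarrow> L) (at_right 1)" "quant_dim \<nu> = inverse (ereal L)"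
      using tendsto_scaled_Z[OF exists] by blast
    have "Lim (at_right 1) scaled_Z = L"
      by (rule tendsto_Lim[OF trivial_limit_at_right_real L(1)])
    then show ?thesis using L(2) unfolding scaled_Z_def[abs_def] Z_sum_def by (simp only:)
  qed
  show ?thesis
    unfolding scaled_Z_def[symmetric]
    using summable_powr Z_sum_sums summable_on_finite[OF finite_F_cubes] finite_summable
      F_fun_eq_L_fun[OF less_imp_le] F_fun_neg mono_F_fun continuous_F_fun emeasure_interval_F emeasure_atom_0
      Z_sum_eq_LINT inverse_upper_quant_dim_le inverse_lower_quant_dim_ge quant_dim_exists_iff dim
      Liminf_le_Limsup[OF trivial_limit_at_right_real, of "1::real" "\<lambda>q. ereal (scaled_Z q)"]
    by (intro conjI allI impI) assumption+
qed

end
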